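(* Let $G$ be a simple directed graph on $n$ vertices with no self-loops, $k$ a positive integer, $p\ge 2n^5$ a prime, and $K,B,C,A,P_i,Q_j,D_{ij},F_{s,t}$ as described below. Then with probability at least $1-5/n$, the matrix $I-K$ is invertible and for every ordered pair $(s,t)$ of distinct vertices: if $(s,t)$ is an edge then $\operatorname{rank}F_{s,t}-1=\min(k,\nu(s,t))$, and if $(s,t)$ is not an edge then $\min(k,\operatorname{rank}F_{s,t})=\min(k,\nu(s,t))$. (That is, the algorithm that computes $(I-K)^{-1}$, all $D_{ij}$, and outputs these values correctly solves $k$-APVC with this probability.)
   Context: $K$ is the $n\times n$ matrix over $\mathbb{F}_p$, rows and columns indexed by vertices, with $K[u,v]$ an independent uniform random element of $\mathbb{F}_p$ if $(u,v)$ is an edge and $0$ otherwise. $B$ ($(k+1)\times n$) and $C$ ($n\times(k+1)$) have independent uniform random entries from $\mathbb{F}_p$, independent of $K$. $A$ is the $n\times n$ adjacency matrix with self-loops: $A[u,v]=1$ if $v=u$ or $(u,v)$ is an edge, else $0$. For $i\in[k+1]$, $P_i$ is the $n\times n$ diagonal matrix with $P_i[u,u]=B[i,u]$, and $Q_i$ is the diagonal matrix with $Q_i[u,u]=C[u,i]$. For $(i,j)\in[k+1]^2$, $D_{ij}=AP_i(I-K)^{-1}Q_jA^\top$. For vertices $s,t$, $F_{s,t}$ is the $(k+1)\times(k+1)$ matrix with $F_{s,t}[i,j]=D_{ij}[s,t]$. $\nu(s,t)$ is the maximum number of internally vertex-disjoint paths from $s$ to $t$ (the one-edge path $s\to t$,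 if present, counts); $k$-APVC asks for $\min(k,\nu(s,t))$ for all pairs. The paper takes $p=\tilde\Theta(n^5)$ with $p\ge 2n^5$.
   Formalization: D_ij is taken as A P_i (I-K)^{-1} Q_j A, with A in place of A^T as last factor, so that in-neighbours of t are selected; with A^T the claim fails for directed graphs (e.g. a single edge s→t, n≥6, where rank F_{s,t} ≤ 1), and the two agree for symmetric graphs. *)

theory Defs
  imports
    "HOL-Probability.Probability"
    "Graph_Theory.Vertex_Walk"
    "Berlekamp_Zassenhaus.Finite_Field"
begin

definition st_paths :: "('v, 'e) pre_digraph \<Rightarrow> 'v \<Rightarrow> 'v \<Rightarrow> 'v list set" where
  "st_paths G s t = {p. vpath p G \<and> hd p = s \<and> last p = t}"

definition internal_vertices :: "'v list \<Rightarrow> 'v set" where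
  "internal_vertices p = set (butlast (tl p))"

definition internally_disjoint :: "'v list set \<Rightarrow> bool" where
  "internally_disjoint S \<longleftrightarrow>
     (\<forall>p\<in>S. \<forall>q\<in>S. p \<noteq> q \<longrightarrow> internal_vertices p \<inter> internal_vertices q = {})"

text \<open>
  A path is determined by its list of vertices only when there are no parallel arcs, and the
  maximum below is over a finite nonempty set only when the graph is finite; both hold for a
  \<^locale>\<open>digraph\<close>.
\<close>
definition vertex_connectivity :: "('v, 'e) pre_digraph \<Rightarrow> 'v \<Rightarrow> 'v \<Rightarrow> nat" where
  "vertex_connectivity G s t = Max {card S | S. S \<subseteq> st_paths G s t \<and> internally_disjoint S}"

definition loop_adjacency :: "('v::finite, 'e) pre_digraph \<Rightarrow> 'a::zero_neq_one^'v^'v" where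
  "loop_adjacency G = (\<chi> u v. if v = u \<or> (u, v) \<in> arcs_ends G then 1 else 0)"

definition diag_matrix :: "('n \<Rightarrow> 'a::zero) \<Rightarrow> 'a^'n^'n" where
  "diag_matrix d = (\<chi> u v. if u = v then d u else 0)"

definition P_matrix :: "'a::zero^'v^'k \<Rightarrow> 'k \<Rightarrow> 'a^'v^'v" where
  "P_matrix B i = diag_matrix (\<lambda>u. B $ i $ u)"

definition Q_matrix :: "'a::zero^'k^'v \<Rightarrow> 'k \<Rightarrow> 'a^'v^'v" where
  "Q_matrix C j = diag_matrix (\<lambda>u. C $ u $ j)"

text \<open>
  The right-hand factor must select the rows \<open>v\<close> with \<open>v = t\<close> or \<open>(v, t)\<close> an edge, so that
  entry \<open>(s, t)\<close> of the product is
  \<open>\<Sum>u\<in>{s} \<union> Out(s). \<Sum>v\<in>{t} \<union> In(t). B[i,u] * (I - K)\<^sup>-\<^sup>1[u,v] * C[v,j]\<close>.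
  Since \<open>A[u,v]\<close> refers to the edge \<open>u \<rightarrow> v\<close>, that factor is \<open>A\<close> itself. The transpose of \<open>A\<close>,
  sometimes written here, agrees with it for symmetric graphs only; for directed graphs it would
  select the out-neighbours of \<open>t\<close>.
\<close>
definition D_matrix ::
  "('v::finite, 'e) pre_digraph \<Rightarrow> 'a::field^'v^'v \<Rightarrow> 'a^'v^'k \<Rightarrow> 'a^'k^'v \<Rightarrow> 'k \<Rightarrow> 'k \<Rightarrow> 'a^'v^'v"
where
  "D_matrix G K B C i j =
     loop_adjacency G ** P_matrix B i ** matrix_inv (mat 1 - K) ** Q_matrix C j ** loop_adjacency G"

definition F_matrix ::
  "('v::finite, 'e) pre_digraph \<Rightarrow> 'a::field^'v^'v \<Rightarrow> 'a^'v^'k \<Rightarrow> 'a^'k^'v \<Rightarrow> 'v \<Rightarrow> 'v \<Rightarrow> 'a^'k^'k"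
where
  "F_matrix G K B C s t = (\<chi> i j. D_matrix G K B C i j $ s $ t)"

text \<open>The positions in \<open>S\<close> carry independent uniform entries; all other entries are \<open>0\<close>.\<close>
definition random_matrix :: "('m::finite \<times> 'n::finite) set \<Rightarrow> ('a::{finite,zero}^'n^'m) pmf" where
  "random_matrix S = map_pmf (\<lambda>f. \<chi> i j. f (i, j)) (Pi_pmf S 0 (\<lambda>_. pmf_of_set UNIV))"

end

theory Submission
  imports Defs
begin

text \<open>
  Let \<open>S = {s} \<union> Out(s)\<close> and \<open>T = {t} \<union> In(t)\<close>, so that \<open>F\<close> is the product of \<open>B\<close> restricted to
  the columns \<open>S\<close>, of \<open>(I - K)\<^sup>-\<^sup>1\<close>, and of \<open>C\<close> restricted to the rows \<open>T\<close>. By Menger's theorem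
  applied to the graph without \<open>s\<close> and \<open>t\<close>, there are as many vertex-disjoint paths from \<open>S\<close> to \<open>T\<close>
  as vertices in some separator of \<open>S\<close> from \<open>T\<close>; this number \<open>q\<close> is \<open>\<nu>(s, t) + 1\<close> if \<open>(s, t)\<close> is
  an edge, and \<open>\<nu>(s, t)\<close> otherwise. The separator bounds the rank of \<open>F\<close> by \<open>q\<close> whenever \<open>I - K\<close> is
  invertible. Conversely, a minor of \<open>F\<close> of order \<open>min (k + 1) q\<close>, multiplied by \<open>det (I - K)\<close>, is the
  determinant of a bordered matrix and hence affine in each of at most \<open>3 n\<^sup>2\<close> independent uniform
  entries. It does not vanish when \<open>K\<close> is the arc indicator of \<open>q\<close> disjoint paths, so it is zero with
  probability at most \<open>3 n\<^sup>2 / p\<close>. A union bound over all pairs and \<open>det (I - K) = 0\<close> gives failure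
  probability at most \<open>(3 n\<^sup>4 + n\<^sup>2) / p \<le> 5 / n\<close>.
\<close>

section \<open>Menger's theorem for vertex sets\<close>

text \<open>
  The witness \<open>U\<close> is the part reachable from \<open>A\<close> without meeting \<open>X\<close>; a separator is thus given by
  its certificate instead of a statement about all paths.
\<close>
definition separator :: "('a \<times> 'a) set \<Rightarrow> 'a set \<Rightarrow> 'a set \<Rightarrow> 'a set \<Rightarrow> bool" where
  "separator E A B X \<longleftrightarrow>
     (\<exists>U. U \<inter> X = {} \<and> A \<subseteq> U \<union> X \<and> B \<inter> U = {} \<and> E `` U \<subseteq> U \<union> X)"

lemma separatorI:
  assumes "U \<inter> X = {}" "A \<subseteq> U \<union> X" "B \<inter> U = {}" "\<And>u v. u \<in> U \<Longrightarrow> (u, v) \<in> E \<Longrightarrow> v \<in> U \<union> X"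
  shows "separator E A B X"
  unfolding separator_def using assms by (intro exI[of _ U]) blast

text \<open>Only the two ends are constrained, so inner vertices may lie in \<open>A\<close> or
  \<open>B\<close>, and a vertex of \<open>A \<inter> B\<close> alone is a path.\<close>

definition linking_path :: "('a \<times> 'a) set \<Rightarrow> 'a set \<Rightarrow> 'a set \<Rightarrow> 'a list \<Rightarrow> bool" where
  "linking_path E A B p \<longleftrightarrow>
     p \<noteq> [] \<and> distinct p \<and> successively (\<lambda>u v. (u, v) \<in> E) p \<and> hd p \<in> A \<and> last p \<in> B"

definition disjoint_paths :: "'a list set \<Rightarrow> bool" where
  "disjoint_paths P \<longleftrightarrow> (\<forall>p\<in>P. \<forall>q\<in>P. p \<noteq> q \<longrightarrow> set p \<inter> set q = {})"

lemma disjoint_pathsD: "disjoint_paths P \<Longrightarrow> p \<in> P \<Longrightarrow> q \<in> P \<Longrightarrow> z \<in> set p \<Longrightarrow> z \<in> set q \<Longrightarrow> p = q"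
  by (auto simp: disjoint_paths_def)

lemma linking_path_mono:
  "linking_path E A B p \<Longrightarrow> E \<subseteq> E' \<Longrightarrow> A \<subseteq> A' \<Longrightarrow> B \<subseteq> B' \<Longrightarrow> linking_path E' A' B' p"
  unfolding linking_path_def
  by (metis (no_types, lifting) subsetD successively_mono[of "\<lambda>u v. (u, v) \<in> E" p "\<lambda>u v. (u, v) \<in> E'"])

text \<open>An arc from \<open>U\<close> can only leave \<open>U\<close> into \<open>X\<close>. Only
  the tail must avoid \<open>X\<close>, which suits suffixes of paths that begin inside
  \<open>U\<close>.\<close>

lemma successively_closed:
  assumes "successively (\<lambda>u v. (u, v) \<in> E) p" "p \<noteq> []" "hd p \<in> U" "E `` U \<subseteq> U \<union> X" "set (tl p) \<inter> X = {}"
  shows "set p \<subseteq> U"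
  using assms
proof (induction p)
  case (Cons a p)
  show ?case
  proof (cases p)
    case (Cons b q)
    have "(a, b) \<in> E" using Cons.prems(1) \<open>p = b # q\<close> by simp
    moreover have "a \<in> U" "b \<notin> X" using Cons.prems \<open>p = b # q\<close> by auto
    ultimately have "b \<in> U" using Cons.prems(4) by blast
    then have "set p \<subseteq> U" using Cons.IH Cons.prems \<open>p = b # q\<close> by auto
    then show ?thesis using Cons.prems(3) by simp
  qed (use Cons.prems in auto)
qed simp

text \<open>A path missing \<open>X\<close> would start in the witness \<open>U\<close> and stay
  there, but \<open>U\<close> contains no vertex of \<open>B\<close>.\<close>

lemma linking_path_meets_separator:
  assumes "separator E A B X" "linking_path E A B p"
  shows "set p \<inter> X \<noteq> {}"
proof
  assume disj: "set p \<inter> X = {}"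
  obtain U where U: "A \<subseteq> U \<union> X" "B \<inter> U = {}" "E `` U \<subseteq> U \<union> X"
    using assms(1) by (auto simp: separator_def)
  have p: "p \<noteq> []" "successively (\<lambda>u v. (u, v) \<in> E) p" "hd p \<in> A" "last p \<in> B"
    using assms(2) by (auto simp: linking_path_def)
  have "hd p \<in> U" using p(1,3) U(1) disj hd_in_set[of p] by blast
  moreover have "set (tl p) \<inter> X = {}" using disj p(1) by (metis Int_mono bot.extremum_uniqueI list.set_sel(2) subset_refl subsetI)
  ultimately have "set p \<subseteq> U" using successively_closed[OF p(2,1) _ U(3)] by blast
  then show False using p(1,4) U(2) last_in_set[of p] by blast
qed

text \<open>Disjoint paths have distinct ends, so by counting \<open>last\<close> maps
  \<open>P\<close> onto \<open>X\<close>. If \<open>z \<in> X\<close> lies on \<open>f a\<close>, it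
  also ends \<open>f z\<close>; hence \<open>f z = f a\<close> and \<open>z = a\<close>.\<close>

lemma menger_family_bij:
  assumes "finite X" "card P = card X" "disjoint_paths P" "\<forall>p\<in>P. linking_path E A X p"
  obtains f where "\<forall>a\<in>X. f a \<in> P \<and> last (f a) = a" "\<forall>a\<in>X. set (f a) \<inter> X = {a}"
proof -
  have in_X: "\<forall>p\<in>P. p \<noteq> [] \<and> last p \<in> X" using assms(4) by (auto simp: linking_path_def)
  have "inj_on last P"
    using in_X disjoint_pathsD[OF assms(3)] by (metis (no_types, lifting) inj_onI last_in_set)
  moreover have "last ` P \<subseteq> X" using in_X by auto
  ultimately have img: "last ` P = X"
    using assms(1,2) by (metis card_image card_subset_eq)
  define f where "f = inv_into P last"
  have f: "\<forall>a\<in>X. f a \<in> P \<and> last (f a) = a"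
    unfolding f_def using img by (metis f_inv_into_f inv_into_into)
  moreover have "\<forall>a\<in>X. set (f a) \<inter> X = {a}"
  proof (intro ballI equalityI subsetI)
    fix a z assume a: "a \<in> X" and z: "z \<in> set (f a) \<inter> X"
    have "z \<in> set (f z)" using f z in_X by (metis IntD2 last_in_set)
    then have "f z = f a" using disjoint_pathsD[OF assms(3)] f a z by blast
    then show "z \<in> {a}" using f a z by (metis IntD2 singletonI)
  next
    fix a z assume "a \<in> X" "z \<in> {a}"
    then show "z \<in> set (f a) \<inter> X" using f in_X by (metis IntI last_in_set singletonD)
  qed
  ultimately show ?thesis by (rule that)
qed

lemma linking_path_rev:
  "linking_path E A B p \<longleftrightarrow> linking_path (E\<inverse>) B A (rev p)"
  by (auto simp: linking_path_def hd_rev last_rev)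

lemma disjoint_paths_rev: "disjoint_paths P \<Longrightarrow> disjoint_paths (rev ` P)"
  by (auto simp: disjoint_paths_def)

lemma menger_family_bij_hd:
  assumes "finite X" "card P = card X" "disjoint_paths P" "\<forall>p\<in>P. linking_path E X B p"
  obtains g where "\<forall>a\<in>X. g a \<in> P \<and> hd (g a) = a" "\<forall>a\<in>X. set (g a) \<inter> X = {a}"
proof -
  have "card (rev ` P) = card X" using assms(2) by (metis card_image inj_on_rev)
  moreover have "\<forall>p\<in>rev ` P. linking_path (E\<inverse>) B X p"
    using assms(4) linking_path_rev by blast
  ultimately obtain f where f: "\<forall>a\<in>X. f a \<in> rev ` P \<and> last (f a) = a" "\<forall>a\<in>X. set (f a) \<inter> X = {a}"
    using menger_family_bij[OF assms(1) _ disjoint_paths_rev[OF assms(3)]] by metis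
  have "\<forall>a\<in>X. rev (f a) \<in> P \<and> hd (rev (f a)) = a" "\<forall>a\<in>X. set (rev (f a)) \<inter> X = {a}"
    using f by (auto simp: hd_rev)
  then show ?thesis using that[of "\<lambda>a. rev (f a)"] by blast
qed

lemma glued_paths_disjoint:
  assumes f: "\<forall>a\<in>insert x S. f a \<in> P" "\<forall>a\<in>insert x S. set (f a) \<inter> insert x S = {a}"
    and g: "\<forall>b\<in>insert y S. g b \<in> Q" "\<forall>b\<in>insert y S. set (g b) \<inter> insert y S = {b}"
    and h: "\<forall>a\<in>S. set (h a) = set (f a) \<union> set (g a)" "set (h x) = set (f x) \<union> set (g y)"
    and disj: "disjoint_paths P" "disjoint_paths Q"
    and meet: "\<forall>p\<in>P. \<forall>q\<in>Q. set p \<inter> set q \<subseteq> S"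
    and "x \<notin> S" "y \<notin> S" "a \<in> insert x S" "b \<in> insert x S" "a \<noteq> b"
  shows "set (h a) \<inter> set (h b) = {}"
proof (rule ccontr)
  define m where "m c = (if c = x then y else c)" for c
  have m: "m c \<in> insert y S" if "c \<in> insert x S" for c using that by (auto simp: m_def)
  have hset: "set (h c) = set (f c) \<union> set (g (m c))" if "c \<in> insert x S" for c
    using h that \<open>x \<notin> S\<close> by (auto simp: m_def)
  have minj: "m c = m d \<Longrightarrow> c = d" if "c \<in> insert x S" "d \<in> insert x S" for c d
    using that \<open>y \<notin> S\<close> by (auto simp: m_def split: if_splits)
  \<comment> \<open>By \<open>meet\<close>, a common vertex of an \<open>f\<close>-path and a
    \<open>g\<close>-path lies in \<open>S\<close>, where it is the only marked vertex of either
    path, hence their common junction.\<close>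
  have fg: "z = c \<and> c = d" if "c \<in> insert x S" "d \<in> insert x S" "z \<in> set (f c)" "z \<in> set (g (m d))" for c d z
  proof -
    have "z \<in> S" using meet f(1) g(1) m that by blast
    then have "z = c" "z = m d" using f(2) g(2) m that by blast+
    then show ?thesis using \<open>z \<in> S\<close> \<open>y \<notin> S\<close> \<open>x \<notin> S\<close> by (auto simp: m_def split: if_splits)
  qed
  assume "set (h a) \<inter> set (h b) \<noteq> {}"
  then obtain z where z: "z \<in> set (h a)" "z \<in> set (h b)" by blast
  have ff: "c = d" if "c \<in> insert x S" "d \<in> insert x S" "z \<in> set (f c)" "z \<in> set (f d)" for c d
  proof -
    have "f c = f d" using disjoint_pathsD[OF disj(1)] f(1) that by blast
    then have "{c} = {d}" using f(2) that by metis
    then show ?thesis by simp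
  qed
  have gg: "c = d" if "c \<in> insert x S" "d \<in> insert x S" "z \<in> set (g (m c))" "z \<in> set (g (m d))" for c d
  proof -
    have "g (m c) = g (m d)" using disjoint_pathsD[OF disj(2)] g(1) m that by blast
    then have "{m c} = {m d}" using g(2) m that by metis
    then show ?thesis using minj that by simp
  qed
  have "z \<in> set (f a) \<or> z \<in> set (g (m a))" "z \<in> set (f b) \<or> z \<in> set (g (m b))"
    using z hset \<open>a \<in> insert x S\<close> \<open>b \<in> insert x S\<close> by auto
  then show False
    using ff[of a b] gg[of a b] fg[of a b z] fg[of b a z]
      \<open>a \<in> insert x S\<close> \<open>b \<in> insert x S\<close> \<open>a \<noteq> b\<close> by metis
qed

text \<open>
  Goering's argument: if deleting the arc \<open>(x, y)\<close> leaves a separator \<open>S\<close> with fewer than \<open>k\<close>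
  vertices, then \<open>k\<close> disjoint paths lead from \<open>A\<close> to \<open>S \<union> {x}\<close> and \<open>k\<close> from \<open>S \<union> {y}\<close> to \<open>B\<close>,
  and they are glued at \<open>S\<close> and along \<open>(x, y)\<close>.
\<close>
lemma menger_sets_aux:
  assumes "finite E" "finite A" "finite B"
    and "\<And>X. finite X \<Longrightarrow> separator E A B X \<Longrightarrow> k \<le> card X"
  shows "\<exists>P. card P = k \<and> disjoint_paths P \<and> (\<forall>p\<in>P. linking_path E A B p)"
  using assms
proof (induction E arbitrary: A B rule: finite_induct)
  case empty
  \<comment> \<open>Without arcs the only paths are single vertices of \<open>A \<inter> B\<close>,
    and this set is itself a separator.\<close>
  have "separator {} A B (A \<inter> B)"
    unfolding separator_def by (rule exI[of _ "A - B"]) auto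
  then have "k \<le> card (A \<inter> B)" using empty by auto
  then obtain C where C: "C \<subseteq> A \<inter> B" "card C = k" by (metis obtain_subset_with_card_n)
  show ?case
    by (rule exI[of _ "(\<lambda>a. [a]) ` C"])
      (use C in \<open>auto simp: disjoint_paths_def linking_path_def card_image inj_on_def\<close>)
next
  case (insert e F)
  obtain x y where e: "e = (x, y)" by (cases e)
  show ?case
  proof (cases "\<forall>X. finite X \<longrightarrow> separator F A B X \<longrightarrow> k \<le> card X")
    case True
    then obtain P where P: "card P = k" "disjoint_paths P" "\<forall>p\<in>P. linking_path F A B p"
      using insert.IH[OF insert.prems(1,2)] by metis
    then have "\<forall>p\<in>P. linking_path (insert e F) A B p" by (meson linking_path_mono order_refl subset_insertI)
    then show ?thesis using P by blast
  next
    case False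
    then obtain S U where S: "finite S" "card S < k"
      and U: "U \<inter> S = {}" "A \<subseteq> U \<union> S" "B \<inter> U = {}" "F `` U \<subseteq> U \<union> S"
      unfolding separator_def by force
    have no: "\<not> separator (insert e F) A B S" using insert.prems(3) S by fastforce
    \<comment> \<open>\<open>S\<close> is too small to separate in the larger graph, so the new arc
      must leave \<open>U \<union> S\<close> from \<open>U\<close>.\<close>
    have xy: "x \<in> U" "y \<notin> U" "y \<notin> S"
      proof -
      have "\<not> insert e F `` U \<subseteq> U \<union> S" using no U(1-3) unfolding separator_def by blast
      then show "x \<in> U" "y \<notin> U" "y \<notin> S" using U(4) e by auto
    qed
    then have "x \<notin> S" using U(1) by blast
    \<comment> \<open>A separator \<open>Z\<close> of \<open>A\<close> from
      \<open>S \<union> {x}\<close> also separates \<open>A\<close> from \<open>B\<close>: its side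
      \<open>V\<close> omits \<open>x\<close>, so the new arc never starts in
      \<open>V \<inter> U\<close>.\<close>
    have kX: "k \<le> card Z" if Z: "finite Z" "separator F A (insert x S) Z" for Z
    proof -
      obtain V where V: "V \<inter> Z = {}" "A \<subseteq> V \<union> Z" "insert x S \<inter> V = {}" "F `` V \<subseteq> V \<union> Z"
        using Z(2) by (auto simp: separator_def)
      have "separator (insert e F) A B Z"
      proof (rule separatorI[where U = "V \<inter> U"])
        fix u v assume uv: "u \<in> V \<inter> U" "(u, v) \<in> insert e F"
        then have "u \<noteq> x" using V(3) by blast
        then have "(u, v) \<in> F" using uv(2) e by simp
        then have "v \<in> V \<union> Z" "v \<in> U \<union> S" using uv(1) V(4) U(4) by blast+
        then show "v \<in> V \<inter> U \<union> Z" using V(3) by blast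
      qed (use V(1-3) U(2,3) in blast)+
      then show ?thesis using insert.prems(3) Z(1) by blast
    qed
    \<comment> \<open>Dually, the new arc ends in \<open>y\<close>, which lies in
      \<open>V \<union> Z\<close>, as does all of \<open>S\<close>; so \<open>V \<union> U\<close>
      can only be left through \<open>Z\<close>.\<close>
    have kY: "k \<le> card Z" if Z: "finite Z" "separator F (insert y S) B Z" for Z
    proof -
      obtain V where V: "V \<inter> Z = {}" "insert y S \<subseteq> V \<union> Z" "B \<inter> V = {}" "F `` V \<subseteq> V \<union> Z"
        using Z(2) by (auto simp: separator_def)
      have "separator (insert e F) A B Z"
      proof (rule separatorI[where U = "(V \<union> U) - Z"])
        fix u v assume uv: "u \<in> V \<union> U - Z" "(u, v) \<in> insert e F"
        then have "v = y \<or> v \<in> V \<union> Z \<or> v \<in> U \<union> S" using V(4) U(4) e by blast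
        then show "v \<in> V \<union> U - Z \<union> Z" using V(2) by blast
      qed (use V(1-3) U(2,3) in blast)+
      then show ?thesis using insert.prems(3) Z(1) by blast
    qed
    obtain P where P: "card P = k" "disjoint_paths P" "\<forall>p\<in>P. linking_path F A (insert x S) p"
      using insert.IH[OF insert.prems(1) _ kX] S(1) by blast
    obtain Q where Q: "card Q = k" "disjoint_paths Q" "\<forall>q\<in>Q. linking_path F (insert y S) B q"
      using insert.IH[OF _ insert.prems(2) kY] S(1) by blast
    \<comment> \<open>This forces \<open>k \<le> card S + 1\<close>; with \<open>card S < k\<close>
      both end sets have exactly \<open>k\<close> elements, one for each path.\<close>
    have "separator F A (insert x S) (insert x S)"
      unfolding separator_def by (rule exI[of _ "U - {x}"]) (use U in blast)
    then have k: "card (insert x S) = k" "card (insert y S) = k"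
      using kX[of "insert x S"] S \<open>x \<notin> S\<close> xy(3) by auto
    obtain f where f: "\<forall>a\<in>insert x S. f a \<in> P \<and> last (f a) = a" "\<forall>a\<in>insert x S. set (f a) \<inter> insert x S = {a}"
      using menger_family_bij[of "insert x S" P F A] P k S(1) by auto
    obtain g where g: "\<forall>a\<in>insert y S. g a \<in> Q \<and> hd (g a) = a" "\<forall>a\<in>insert y S. set (g a) \<inter> insert y S = {a}"
      using menger_family_bij_hd[of "insert y S" Q F B] Q k S(1) by auto
    have fP: "linking_path F A (insert x S) (f a)" "last (f a) = a" if "a \<in> insert x S" for a
      using f P(3) that by auto
    have gQ: "linking_path F (insert y S) B (g a)" "hd (g a) = a" if "a \<in> insert y S" for a
      using g Q(3) that by auto
    \<comment> \<open>Before its last vertex, \<open>f a\<close> avoids \<open>S\<close>, so it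
      cannot leave \<open>U\<close>.\<close>
    have fU: "set (f a) \<subseteq> U \<union> S" if a: "a \<in> insert x S" for a
    proof -
      have "f a \<noteq> []" using fP[OF a] by (auto simp: linking_path_def)
      then have fa: "f a = butlast (f a) @ [a]" using fP(2)[OF a] by (metis append_butlast_last_id)
      have d: "distinct (butlast (f a) @ [a])" "successively (\<lambda>u v. (u, v) \<in> F) (butlast (f a) @ [a])"
          "hd (butlast (f a) @ [a]) \<in> A"
        using fP(1)[OF a] fa by (auto simp: linking_path_def)
      have dis: "set (butlast (f a)) \<inter> S = {}" using f(2) a d(1) in_set_butlastD by fastforce
      have "set (butlast (f a)) \<subseteq> U"
      proof (cases "butlast (f a) = []")
        case False
        have "hd (butlast (f a)) \<in> U" using d(3) False dis U(2) by (metis (no_types, lifting) UnE disjoint_iff hd_append2 hd_in_set subsetD)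
        moreover have "set (tl (butlast (f a))) \<inter> S = {}" using dis False by (metis disjoint_iff list.set_sel(2))
        moreover have "successively (\<lambda>u v. (u, v) \<in> F) (butlast (f a))" using d(2) by (simp only: successively_append_iff)
        ultimately show ?thesis using successively_closed False U(4) by metis
      qed simp
      moreover have "set (f a) = insert a (set (butlast (f a)))" using fa by (metis list.simps(15) rotate1.simps(2) set_rotate1)
      ultimately show ?thesis using a xy(1) by auto
    qed
    \<comment> \<open>If \<open>g b\<close> entered \<open>U\<close>, the rest of it would avoid
      \<open>S\<close>, whose only possible vertex \<open>b\<close> has already been passed; it
      would then end in \<open>U\<close>, away from \<open>B\<close>.\<close>
    have gU: "set (g b) \<inter> U = {}" if b: "b \<in> insert y S" for b
    proof (rule ccontr)
      assume "set (g b) \<inter> U \<noteq> {}"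
      then obtain u q r where u: "u \<in> U" "g b = q @ u # r" by (metis disjoint_iff split_list)
      have "b \<notin> U" using b xy U(1) by blast
      have "q \<noteq> []" using gQ(2)[OF b] u \<open>b \<notin> U\<close> by auto
      then have "b \<in> set q" using gQ(2)[OF b] u(2) by (metis hd_append2 hd_in_set)
      have gb: "distinct (g b)" "successively (\<lambda>u v. (u, v) \<in> F) (u # r)" "last (g b) \<in> B"
        using gQ(1)[OF b] u(2) by (auto simp: linking_path_def successively_append_iff)
      have "set r \<inter> S = {}" using g(2) b gb(1) \<open>b \<in> set q\<close> u(2) by fastforce
      then have "set (u # r) \<subseteq> U" using successively_closed[OF gb(2) _ _ U(4)] u by simp
      moreover have "last (g b) \<in> set (u # r)" using u(2) by simp
      ultimately show False using gb(3) U(3) by blast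
    qed
    \<comment> \<open>At \<open>a \<in> S\<close> both paths contain \<open>a\<close>, so one copy
      is dropped; at \<open>x\<close> the paths are joined by the new arc.\<close>
    define h where "h a = (if a = x then f x @ g y else f a @ tl (g a))" for a
    have hx: "h x = f x @ g y" and hS: "a \<in> S \<Longrightarrow> h a = f a @ tl (g a)" for a
      using \<open>x \<notin> S\<close> by (auto simp: h_def)
    have gtl: "g a = a # tl (g a)" if "a \<in> S" for a
      using gQ[of a] that by (metis insertCI linking_path_def list.collapse)
    have alast: "a \<in> set (f a)" if "a \<in> insert x S" for a
      using f(2) that by blast
    have h_set: "\<forall>a\<in>S. set (h a) = set (f a) \<union> set (g a)" "set (h x) = set (f x) \<union> set (g y)"
    proof -
      show "\<forall>a\<in>S. set (h a) = set (f a) \<union> set (g a)"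
      proof
        fix a assume a: "a \<in> S"
        have "set (g a) = insert a (set (tl (g a)))" using gtl[OF a] by (metis list.simps(15))
        then show "set (h a) = set (f a) \<union> set (g a)" using hS[OF a] alast a by auto
      qed
    qed (simp add: hx)
    have meet: "set (f a) \<inter> set (g b) \<subseteq> S" if "a \<in> insert x S" "b \<in> insert y S" for a b
      using fU[OF that(1)] gU[OF that(2)] by blast
    have h_disj: "set (h a) \<inter> set (h b) = {}" if "a \<in> insert x S" "b \<in> insert x S" "a \<noteq> b" for a b
    proof (rule glued_paths_disjoint[of x S f "f ` insert x S" y g "g ` insert y S"])
      show "disjoint_paths (f ` insert x S)" "disjoint_paths (g ` insert y S)"
        using P(2) Q(2) f(1) g(1) by (auto simp: disjoint_paths_def)
      show "\<forall>p\<in>f ` insert x S. \<forall>q\<in>g ` insert y S. set p \<inter> set q \<subseteq> S" using meet by blast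
    qed (use f g h_set \<open>x \<notin> S\<close> xy that in auto)
    have h_path: "linking_path (insert e F) A B (h a)" if a: "a \<in> insert x S" for a
    proof (cases "a = x")
      case True
      have 1: "set (f x) \<inter> set (g y) = {}"
      proof -
        have "set (f x) \<inter> set (g y) \<subseteq> S" "set (f x) \<inter> insert x S = {x}" using meet f(2) by simp_all
        then show ?thesis using \<open>x \<notin> S\<close> equalityD1[of "set (f x) \<inter> insert x S"] by blast
      qed
      have "linking_path (insert e F) A (insert x S) (f x)" "linking_path (insert e F) (insert y S) B (g y)"
        using fP(1)[of x] gQ(1)[of y] by (meson insertI1 linking_path_mono order_refl subset_insertI)+
      then show ?thesis using 1 fP(2)[of x] gQ(2)[of y] True
        by (auto simp: hx linking_path_def successively_append_iff e)
    next
      case False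
      then have aS: "a \<in> S" using a by simp
      have g1: "linking_path (insert e F) (insert y S) B (a # tl (g a))"
        using gQ(1)[of a] gtl[OF aS] aS by (metis insertCI linking_path_mono order_refl subset_insertI)
      have f1: "linking_path (insert e F) A (insert x S) (f a)"
        using fP(1)[OF a] by (meson linking_path_mono order_refl subset_insertI)
      have "set (f a) \<inter> set (g a) \<subseteq> S" "set (f a) \<inter> insert x S = {a}" using meet f(2) aS by simp_all
      then have "set (f a) \<inter> set (g a) \<subseteq> {a}" using equalityD1[of "set (f a) \<inter> insert x S"] by blast
      moreover have "a \<notin> set (tl (g a))" using g1 by (simp add: linking_path_def)
      moreover have "set (tl (g a)) \<subseteq> set (g a)" using gtl[OF aS] by (metis set_subset_Cons)
      ultimately have 1: "set (f a) \<inter> set (tl (g a)) = {}" by blast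
      have ha: "h a = f a @ tl (g a)" using aS hS by simp
      have "last (h a) = last (a # tl (g a))" using f1 fP(2)[OF a] by (auto simp: ha linking_path_def last_append)
      moreover have "successively (\<lambda>u v. (u, v) \<in> insert e F) (h a)"
        using f1 g1 fP(2)[OF a] by (auto simp: ha linking_path_def successively_append_iff successively_Cons)
      ultimately show ?thesis using f1 g1 1 by (auto simp: ha linking_path_def)
    qed
    have h_ne: "set (h a) \<noteq> {}" if "a \<in> insert x S" for a
      using h_path[OF that] by (auto simp: linking_path_def)
    have "inj_on h (insert x S)"
      using h_disj h_ne by (metis (no_types, lifting) Int_absorb inj_onI)
    then have "card (h ` insert x S) = k" using k(1) card_image by metis
    moreover have "disjoint_paths (h ` insert x S)"
      using h_disj by (fastforce simp: disjoint_paths_def)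
    ultimately show ?thesis using h_path by blast
  qed
qed

text \<open>Take a separator \<open>X\<close> of least size; one exists since \<open>A\<close>
  separates itself from \<open>B\<close>.\<close>

lemma menger_sets:
  assumes "finite E" "finite A" "finite B"
  obtains X P where "finite X" "separator E A B X" "card P = card X" "disjoint_paths P"
    "\<forall>p\<in>P. linking_path E A B p"
proof -
  have "\<exists>X. finite X \<and> separator E A B X"
    using assms(2) by (intro exI[of _ A]) (auto simp: separator_def)
  then obtain X where X: "finite X \<and> separator E A B X"
    and min: "\<And>Y. finite Y \<and> separator E A B Y \<Longrightarrow> card X \<le> card Y"
    using exists_least_iff[of "\<lambda>n. \<exists>X. finite X \<and> separator E A B X \<and> card X = n"]
    by (metis not_le)
  from menger_sets_aux[OF assms, of "card X"] min X that show ?thesis by blast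
qed

section \<open>Rank bounds for compressions of an inverse matrix\<close>

lemma linear_vector_matrix_mult:
  "Vector_Spaces.linear (*s) (*s) (\<lambda>x::'a::field^'m. x v* (A::'a^'n^'m))"
  using matrix_vector_mul_linear_gen[of "transpose A"] unfolding transpose_matrix_vector .

lemma vector_matrix_mult_sum:
  "x v* (A::'a::comm_semiring_1^'n^'m) = (\<Sum>i\<in>UNIV. x $ i *s (A $ i))"
  by (simp add: vec_eq_iff vector_matrix_mult_def sum_component)

lemma matrix_matrix_mult_row: "(A ** B) $ i = (A $ i) v* (B::'a::comm_semiring_1^'n^'m)"
  by (simp add: vec_eq_iff vector_matrix_mult_def matrix_matrix_mult_def)

lemma axis_vector_matrix_mult: "axis u 1 v* (A::'a::comm_semiring_1^'n^'m) = A $ u"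
  by (simp add: vec_eq_iff vector_matrix_mult_def axis_def if_distrib [of "\<lambda>x. x * _"] cong: if_cong)

lemma rank_eq_dim_nth: "rank A = vec.dim (range (\<lambda>i. A $ i))"
  by (simp add: row_rank_def_gen rows_def row_def full_SetCompr_eq)

text \<open>An inequality form of rank-nullity: extend a basis \<open>B\<close> of \<open>W\<close>
  to a basis \<open>C\<close> of the span; \<open>f\<close> kills \<open>B\<close>, so the image is
  spanned by \<open>f\<close> applied to \<open>C - B\<close>.\<close>

lemma dim_image_add_dim_kernel_le:
  fixes f :: "'a::field^'n \<Rightarrow> 'a^'m"
  assumes f: "Vector_Spaces.linear (*s) (*s) f" and W: "W \<subseteq> vec.span V" and f0: "\<And>x. x \<in> W \<Longrightarrow> f x = 0"
  shows "vec.dim (f ` vec.span V) + vec.dim W \<le> vec.dim V"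
proof -
  obtain B where B: "B \<subseteq> W" "vec.independent B" "W \<subseteq> vec.span B" "card B = vec.dim W"
    by (rule vec.basis_exists)
  obtain C where C: "B \<subseteq> C" "C \<subseteq> vec.span V" "vec.independent C" "vec.span V \<subseteq> vec.span C"
    by (rule vec.maximal_independent_subset_extend[of B "vec.span V"]) (use B W in auto)
  have fin: "finite C" using C(3) by (rule vec.finiteI_independent)
  have "vec.span C = vec.span V"
    using C by (metis vec.span_mono vec.span_span subset_antisym)
  then have cC: "card C = vec.dim V" using C(3) vec.dim_eq_card by metis
  have "f ` C \<subseteq> insert 0 (f ` (C - B))" using f0 B(1) by auto
  then have "f ` C \<subseteq> vec.span (f ` (C - B))" by (meson insert_subset order_trans vec.span_superset vec.span_zero)
  then have "vec.span (f ` C) \<subseteq> vec.span (f ` (C - B))" by (metis vec.span_mono vec.span_span)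
  moreover have "f ` vec.span V \<subseteq> vec.span (f ` C)"
    using C(4) vec.linear_span_image[OF f] by (metis image_mono)
  ultimately have "vec.dim (f ` vec.span V) \<le> card (f ` (C - B))"
    using fin by (intro vec.dim_le_card) auto
  also have "\<dots> \<le> card (C - B)" using fin by (simp add: card_image_le)
  also have "\<dots> = card C - card B" using fin C(1) by (simp add: card_Diff_subset finite_subset)
  finally have "vec.dim (f ` vec.span V) + card B \<le> card C" using card_mono[OF fin C(1)] by linarith
  then show ?thesis using B(4) cC by simp
qed

lemma independent_axes: "vec.independent ((\<lambda>u. axis u (1::'a::field)) ` (U :: 'n::finite set))"
proof -
  have "(\<lambda>u. axis u (1::'a)) ` U \<subseteq> cart_basis" by (auto simp: cart_basis_def)
  then show ?thesis using independent_cart_basis vec.independent_mono by blast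
qed

lemma card_axes: "card ((\<lambda>u. axis u (1::'a::field)) ` (U :: 'n::finite set)) = card U"
  by (rule card_image) (auto simp: inj_on_def axis_eq_axis)

text \<open>
  The block of \<open>A\<close> with rows in \<open>U\<close> and columns outside \<open>U \<union> X\<close> vanishes, so the rows of \<open>N = A\<^sup>-\<^sup>1\<close>
  with index in \<open>U \<union> X\<close> span the unit vectors of \<open>U\<close>, all of which \<open>R\<close> kills. The principal
  block of \<open>A\<close> on \<open>U\<close> need not be invertible.
\<close>
lemma rank_separated_le:
  fixes A N :: "'a::field^'v^'v" and L :: "'a^'v^'k" and R :: "'a^'k^'v"
  assumes inv: "A ** N = mat 1"
    and L: "\<And>i u. L $ i $ u \<noteq> 0 \<Longrightarrow> u \<in> U \<union> X"
    and R: "\<And>v j. R $ v $ j \<noteq> 0 \<Longrightarrow> v \<notin> U"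
    and A: "\<And>u v. u \<in> U \<Longrightarrow> A $ u $ v \<noteq> 0 \<Longrightarrow> v \<in> U \<union> X"
    and disj: "U \<inter> X = {}"
  shows "rank (L ** N ** R) \<le> card X"
proof -
  let ?V = "(\<lambda>x. N $ x) ` (U \<union> X)"
  let ?W = "(\<lambda>u. axis u (1::'a)) ` U"
  let ?f = "\<lambda>x. x v* R"
  have in_span: "y v* N \<in> vec.span ?V" if y: "\<And>u. y $ u \<noteq> 0 \<Longrightarrow> u \<in> U \<union> X" for y
    unfolding vector_matrix_mult_sum
  proof (rule vec.span_sum)
    fix u show "y $ u *s N $ u \<in> vec.span ?V"
    proof (cases "y $ u = 0")
      case False
      then show ?thesis using y[of u] by (intro vec.span_scale vec.span_base) auto
    qed (simp add: vec.span_zero)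
  qed
  have "?W \<subseteq> vec.span ?V"
  proof
    fix w assume "w \<in> ?W"
    then obtain u where u: "u \<in> U" "w = axis u 1" by auto
    have "w = (A $ u) v* N"
      unfolding u(2) using matrix_matrix_mult_row[of A N u] inv axis_vector_matrix_mult[of u "mat 1 :: 'a^'v^'v"] by simp
    then show "w \<in> vec.span ?V" using in_span[of "A $ u"] A[OF u(1)] by simp
  qed
  moreover have "?f w = 0" if "w \<in> ?W" for w
  proof -
    obtain u where "u \<in> U" "w = axis u 1" using \<open>w \<in> ?W\<close> by blast
    then show ?thesis using R[of u] by (simp add: axis_vector_matrix_mult) (auto simp: vec_eq_iff)
  qed
  ultimately have "vec.dim (?f ` vec.span ?V) + vec.dim ?W \<le> vec.dim ?V"
    by (rule dim_image_add_dim_kernel_le[OF linear_vector_matrix_mult])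
  moreover have "vec.dim ?W = card U"
    using vec.dim_eq_card_independent[OF independent_axes] card_axes by metis
  moreover have "vec.dim ?V \<le> card U + card X"
  proof -
    have "vec.dim ?V \<le> card ?V" by (rule vec.dim_le_card) (auto intro: vec.span_base)
    also have "\<dots> \<le> card (U \<union> X)" by (rule card_image_le) simp
    also have "\<dots> = card U + card X" using disj by (simp add: card_Un_disjoint)
    finally show ?thesis .
  qed
  \<comment> \<open>Each row of \<open>L ** N\<close> combines the rows of \<open>N\<close> indexed
    by \<open>U \<union> X\<close>. With the bounds above,
    \<open>rank + card U \<le> card U + card X\<close>.\<close>
  moreover have "rank (L ** N ** R) \<le> vec.dim (?f ` vec.span ?V)"
    unfolding rank_eq_dim_nth
  proof (rule vec.dim_subset, safe)
    fix i
    have "(L $ i) v* N \<in> vec.span ?V" using L by (intro in_span)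
    then show "(L ** N ** R) $ i \<in> ?f ` vec.span ?V"
      by (auto simp: matrix_matrix_mult_row)
  qed
  ultimately show ?thesis by linarith
qed

section \<open>Lower bounds for the rank from bordered determinants\<close>

text \<open>The vectors supported on \<open>R\<close> embed injectively into the row space of
  \<open>F\<close>.\<close>

lemma card_le_rank:
  fixes F :: "'a::field^'n^'m"
  assumes "\<And>y. (\<And>i. i \<notin> R \<Longrightarrow> y $ i = 0) \<Longrightarrow> y v* F = 0 \<Longrightarrow> y = 0"
  shows "card R \<le> rank F"
proof -
  let ?B = "(\<lambda>u. axis u (1::'a)) ` R" and ?f = "\<lambda>x. x v* F"
  have supp: "y $ i = 0" if "y \<in> vec.span ?B" "i \<notin> R" for y i
    using that(1) by (induction rule: vec.span_induct_alt) (use that(2) in \<open>auto simp: axis_def split: if_splits\<close>)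
  have "inj_on ?f (vec.span ?B)"
  proof (rule inj_onI)
    fix x y assume xy: "x \<in> vec.span ?B" "y \<in> vec.span ?B" "x v* F = y v* F"
    have "x - y = 0"
    proof (rule assms)
      show "(x - y) $ i = 0" if "i \<notin> R" for i using supp[OF vec.span_diff[OF xy(1,2)] that] .
      show "(x - y) v* F = 0" using xy(3) vec.linear_diff[OF linear_vector_matrix_mult, of x y F] by simp
    qed
    then show "x = y" by simp
  qed
  then have "vec.dim (?f ` ?B) = vec.dim ?B"
    by (rule vec.dim_image_eq[OF linear_vector_matrix_mult])
  also have "\<dots> = card R" using vec.dim_eq_card_independent[OF independent_axes] card_axes by metis
  finally have "card R = vec.dim (?f ` ?B)" ..
  also have "\<dots> \<le> rank F"
    unfolding rank_eq_dim_nth by (rule vec.dim_subset) (auto simp: axis_vector_matrix_mult)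
  finally show ?thesis .
qed

text \<open>
  Up to sign, the determinant is \<open>det (I - K)\<close> times the minor of \<open>B (I - K)\<^sup>-\<^sup>1 C\<close> on rows and columns
  \<open>R\<close>, with \<open>B\<close> and \<open>C\<close> restricted to \<open>S\<close> and \<open>T\<close>. In this form it is affine in every entry of
  \<open>K\<close>, \<open>B\<close> and \<open>C\<close>.
\<close>
definition bordered_matrix ::
  "'v set \<Rightarrow> 'v set \<Rightarrow> 'k set \<Rightarrow> 'a::field^'v^'v \<Rightarrow> 'a^'v^'k \<Rightarrow> 'a^'k^'v \<Rightarrow> 'a^('v + 'k)^('v + 'k)"
where
  "bordered_matrix S T R K B C = (\<chi> a b. case a of
       Inl u \<Rightarrow> (case b of Inl v \<Rightarrow> (if u = v then 1 else 0) - K $ u $ v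
                        | Inr j \<Rightarrow> if u \<in> T \<and> j \<in> R then C $ u $ j else 0)
     | Inr i \<Rightarrow> (case b of Inl v \<Rightarrow> if v \<in> S \<and> i \<in> R then B $ i $ v else 0
                        | Inr j \<Rightarrow> if i = j \<and> i \<notin> R then 1 else 0))"

lemma bordered_matrix_nth:
  "bordered_matrix S T R K B C $ Inl u $ Inl v = (if u = v then 1 else 0) - K $ u $ v"
  "bordered_matrix S T R K B C $ Inl u $ Inr j = (if u \<in> T \<and> j \<in> R then C $ u $ j else 0)"
  "bordered_matrix S T R K B C $ Inr i $ Inl v = (if v \<in> S \<and> i \<in> R then B $ i $ v else 0)"
  "bordered_matrix S T R K B C $ Inr i $ Inr j = (if i = j \<and> i \<notin> R then 1 else 0)"
  by (simp_all add: bordered_matrix_def)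

lemma sum_UNIV_Plus:
  "(\<Sum>a\<in>(UNIV :: ('v::finite + 'k::finite) set). f a) = (\<Sum>u\<in>UNIV. f (Inl u)) + (\<Sum>i\<in>UNIV. f (Inr i))"
  by (simp add: UNIV_Plus_UNIV[symmetric] sum.Plus del: UNIV_Plus_UNIV)

text \<open>Columns outside \<open>S\<close> are zeroed instead of deleted, which keeps the type
  independent of \<open>S\<close>.\<close>

definition restrict_cols :: "'v set \<Rightarrow> 'a::zero^'v^'k \<Rightarrow> 'a^'v^'k" where
  "restrict_cols S B = (\<chi> i u. if u \<in> S then B $ i $ u else 0)"

definition restrict_rows :: "'v set \<Rightarrow> 'a::zero^'k^'v \<Rightarrow> 'a^'k^'v" where
  "restrict_rows T C = (\<chi> v j. if v \<in> T then C $ v $ j else 0)"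

text \<open>If \<open>y\<close> is supported on \<open>R\<close> and killed by the product, then
  with \<open>x = - y L N\<close> the vector \<open>(x, y)\<close> is in the left kernel of the
  bordered matrix, hence zero.\<close>

lemma card_le_rank_bordered:
  fixes K N :: "'a::field^'v::finite^'v" and B :: "'a^'v^'k::finite"
  assumes inv: "N ** (mat 1 - K) = mat 1"
    and det: "det (bordered_matrix S T R K B C) \<noteq> 0"
  shows "card R \<le> rank (restrict_cols S B ** N ** restrict_rows T C)"
proof (rule card_le_rank)
  fix y :: "'a^'k"
  let ?L = "restrict_cols S B" and ?R = "restrict_rows T C" and ?M = "bordered_matrix S T R K B C"
  assume supp: "\<And>i. i \<notin> R \<Longrightarrow> y $ i = 0" and ker: "y v* (?L ** N ** ?R) = 0"
  define x where "x = - ((y v* ?L) v* N)"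
  define z where "z = (\<chi> a. case a of Inl u \<Rightarrow> x $ u | Inr i \<Rightarrow> y $ i)"
  have "x v* (mat 1 - K) = - (y v* ?L)"
  proof -
    have "x v* (mat 1 - K) = - (((y v* ?L) v* N) v* (mat 1 - K))"
      unfolding x_def by (rule vec.linear_neg[OF linear_vector_matrix_mult])
    then show ?thesis by (simp add: vector_matrix_mul_assoc matrix_mul_assoc[symmetric] inv)
  qed
  then have 1: "(\<Sum>u\<in>UNIV. x $ u * ((if u = v then 1 else 0) - K $ u $ v)) = - (\<Sum>i\<in>UNIV. y $ i * ?L $ i $ v)" for v
    by (simp add: vec_eq_iff vector_matrix_mult_def mat_def)
  have "x v* ?R = - (y v* (?L ** N ** ?R))"
    unfolding x_def vec.linear_neg[OF linear_vector_matrix_mult]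
    by (simp add: vector_matrix_mul_assoc matrix_mul_assoc)
  then have 2: "(\<Sum>u\<in>UNIV. x $ u * ?R $ u $ j) = 0" for j
    using ker by (simp add: vec_eq_iff vector_matrix_mult_def)
  have "z v* ?M = 0"
  proof -
    have "(z v* ?M) $ Inl v = 0" for v
    proof -
      have "(\<Sum>i\<in>UNIV. y $ i * (if v \<in> S \<and> i \<in> R then B $ i $ v else 0)) = (\<Sum>i\<in>UNIV. y $ i * ?L $ i $ v)"
        by (rule sum.cong) (use supp in \<open>auto simp: restrict_cols_def\<close>)
      then show ?thesis using 1[of v]
        by (simp add: vector_matrix_mult_def sum_UNIV_Plus z_def bordered_matrix_nth)
    qed
    moreover have "(z v* ?M) $ Inr j = 0" for j
    proof (cases "j \<in> R")
      case True
      then have "(\<Sum>u\<in>UNIV. x $ u * (if u \<in> T \<and> j \<in> R then C $ u $ j else 0)) = (\<Sum>u\<in>UNIV. x $ u * ?R $ u $ j)"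
        by (intro sum.cong) (auto simp: restrict_rows_def)
      moreover have "(\<Sum>i\<in>UNIV. y $ i * (if i = j \<and> i \<notin> R then 1 else 0)) = 0"
        using True by (intro sum.neutral) auto
      ultimately show ?thesis using 2[of j]
        by (simp only: vector_matrix_mult_def sum_UNIV_Plus z_def bordered_matrix_nth vec_lambda_beta sum.case) simp
    next
      \<comment> \<open>Outside \<open>R\<close> the border column is a unit vector and returns
        \<open>y $ j\<close>, which vanishes by the support condition.\<close>
      case False
      then have "(\<Sum>u\<in>UNIV. x $ u * (if u \<in> T \<and> j \<in> R then C $ u $ j else 0)) = 0"
        by (intro sum.neutral) auto
      moreover have "(\<Sum>i\<in>UNIV. y $ i * (if i = j \<and> i \<notin> R then 1 else 0)) = 0"
        using supp[OF False] by (intro sum.neutral) auto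
      ultimately show ?thesis
        by (simp only: vector_matrix_mult_def sum_UNIV_Plus z_def bordered_matrix_nth vec_lambda_beta sum.case) simp
    qed
    ultimately have "(z v* ?M) $ a = 0" for a by (cases a) auto
    then show ?thesis by (simp add: vec_eq_iff)
  qed
  moreover have "invertible ?M" using det by (simp add: invertible_det_nz)
  then obtain M' where "?M ** M' = mat 1" by (auto simp: invertible_def)
  then have "z = (z v* ?M) v* M'" by (simp add: vector_matrix_mul_assoc)
  ultimately have "z = 0" by simp
  then have "z $ Inr i = 0" for i by simp
  then show "y = 0" by (simp add: z_def vec_eq_iff)
qed

text \<open>The determinant is linear in row \<open>i\<close>, and \<open>c\<close> enters only
  there, once. The factor \<open>q\<close> allows for the sign in \<open>I - K\<close>
  (\<open>-1\<close>) and for entries masked out by \<open>S\<close>, \<open>T\<close> or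
  \<open>R\<close> (\<open>0\<close>).\<close>

lemma det_affine_entry:
  fixes M :: "'a::comm_ring_1 \<Rightarrow> 'a^'n^'n"
  assumes "\<And>c a b. (a, b) \<noteq> (i, j) \<Longrightarrow> M c $ a $ b = M 0 $ a $ b"
    and "\<And>c. M c $ i $ j = M 0 $ i $ j + c * q"
  shows "\<exists>a b. \<forall>c. det (M c) = a + b * c"
proof -
  have "M c = (\<chi> r. if r = i then M 0 $ i + c *s axis j q else M 0 $ r)" for c
  proof -
    have "M c $ a $ b = (if a = i then M 0 $ i + c *s axis j q else M 0 $ a) $ b" for a b
      using assms(1)[of a b c] assms(2)[of c] by (auto simp: axis_def)
    then show ?thesis by (simp add: vec_eq_iff)
  qed
  then have "det (M c) = det (\<chi> r. if r = i then M 0 $ i else M 0 $ r) + c * det (\<chi> r. if r = i then axis j q else M 0 $ r)" for c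
    using det_row_add[of i "\<lambda>_. M 0 $ i" "\<lambda>_. c *s axis j q" "\<lambda>r. M 0 $ r"]
      det_row_mul[of i c "\<lambda>_. axis j q" "\<lambda>r. M 0 $ r"] by metis
  then have "\<forall>c. det (M c) = det (\<chi> r. if r = i then M 0 $ i else M 0 $ r) + det (\<chi> r. if r = i then axis j q else M 0 $ r) * c"
    by (simp only: mult.commute) simp
  then show ?thesis by blast
qed

text \<open>\<open>K\<close> is the arc indicator of the paths, while \<open>B\<close> and
  \<open>C\<close> mark their first and last vertices. A kernel vector then vanishes at each start,
  and this zero propagates along the path.\<close>

lemma bordered_det_nonzero:
  fixes p :: "'k::finite \<Rightarrow> 'v::finite list"
  assumes paths: "\<And>i. i \<in> R \<Longrightarrow> linking_path E S T (p i)"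
    and disj: "\<And>i j. i \<in> R \<Longrightarrow> j \<in> R \<Longrightarrow> i \<noteq> j \<Longrightarrow> set (p i) \<inter> set (p j) = {}"
  obtains K :: "'a::field^'v^'v" and B C where
    "\<And>u v. (u, v) \<notin> E \<Longrightarrow> K $ u $ v = 0" "det (bordered_matrix S T R K B C) \<noteq> 0"
proof -
  define K :: "'a^'v^'v" where
    "K = (\<chi> u v. if \<exists>i\<in>R. \<exists>m. Suc m < length (p i) \<and> u = p i ! m \<and> v = p i ! Suc m then 1 else 0)"
  define B :: "'a^'v^'k" where "B = (\<chi> i u. if u = hd (p i) then 1 else 0)"
  define C :: "'a^'k^'v" where "C = (\<chi> u j. if u = last (p j) then 1 else 0)"
  let ?M = "bordered_matrix S T R K B C"
  have P: "p i \<noteq> []" "distinct (p i)" "hd (p i) \<in> S" "last (p i) \<in> T"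
      "\<And>m. Suc m < length (p i) \<Longrightarrow> (p i ! m, p i ! Suc m) \<in> E" if "i \<in> R" for i
    using paths[OF that] by (auto simp: linking_path_def successively_conv_nth)
  \<comment> \<open>A vertex determines its path and its position, so each row of \<open>K\<close>
    has at most one nonzero entry.\<close>
  have uniq: "i = j \<and> m = l" if "i \<in> R" "j \<in> R" "m < length (p i)" "l < length (p j)" "p i ! m = p j ! l" for i j m l
  proof -
    have "i = j" using disj[OF that(1,2)] that nth_mem by fastforce
    then show ?thesis using that P(2) by (simp add: nth_eq_iff_index_eq)
  qed
  have "K $ u $ v = 0" if "(u, v) \<notin> E" for u v
    using that P(5) by (auto simp: K_def)
  moreover have "z = 0" if z: "?M *v z = 0" for z
  proof -
    define x where "x u = z $ Inl u" for u
    define y where "y j = z $ Inr j" for j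
    have rowl: "x u = (\<Sum>v\<in>UNIV. K $ u $ v * x v) - (\<Sum>j\<in>UNIV. if u = last (p j) \<and> j \<in> R then y j else 0)" for u
    proof -
      have "(?M *v z) $ Inl u = 0" using z by simp
      moreover have "(\<Sum>j\<in>UNIV. (if u \<in> T \<and> j \<in> R then C $ u $ j else 0) * y j) =
          (\<Sum>j\<in>UNIV. if u = last (p j) \<and> j \<in> R then y j else 0)"
        by (rule sum.cong) (auto simp: C_def P(4))
      moreover have "(\<Sum>v\<in>UNIV. ((if u = v then 1 else 0) - K $ u $ v) * x v) = x u - (\<Sum>v\<in>UNIV. K $ u $ v * x v)"
        by (simp add: left_diff_distrib sum_subtractf if_distrib[of "\<lambda>a. a * _"] cong: if_cong)
      ultimately have "x u - (\<Sum>v\<in>UNIV. K $ u $ v * x v) + (\<Sum>j\<in>UNIV. if u = last (p j) \<and> j \<in> R then y j else 0) = 0"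
        unfolding x_def y_def by (simp add: matrix_vector_mult_def sum_UNIV_Plus bordered_matrix_nth)
      then show ?thesis by (simp add: algebra_simps add_eq_0_iff)
    qed
    have rowr: "(\<Sum>v\<in>UNIV. (if v \<in> S \<and> i \<in> R then B $ i $ v else 0) * x v) + (\<Sum>j\<in>UNIV. (if i = j \<and> i \<notin> R then 1 else 0) * y j) = 0" for i
    proof -
      have "(?M *v z) $ Inr i = 0" using z by simp
      then show ?thesis by (simp add: matrix_vector_mult_def sum_UNIV_Plus bordered_matrix_nth x_def y_def)
    qed
    have hd0: "x (hd (p i)) = 0" if "i \<in> R" for i
    proof -
      have "(\<Sum>v\<in>UNIV. (if v \<in> S \<and> i \<in> R then B $ i $ v else 0) * x v) = (\<Sum>v\<in>UNIV. if v = hd (p i) then x v else 0)"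
        by (rule sum.cong) (use that P(3) in \<open>auto simp: B_def\<close>)
      then show ?thesis using rowr[of i] that by simp
    qed
    have yout: "y i = 0" if "i \<notin> R" for i
      using rowr[of i] that by (simp add: if_distrib[of "\<lambda>a. a * _"] cong: if_cong)
    \<comment> \<open>Before the end of a path, row \<open>p i ! m\<close> of \<open>K\<close>
      selects the successor alone, and no column of \<open>C\<close> is active.\<close>
    have step: "x (p i ! m) = x (p i ! Suc m)" if "i \<in> R" "Suc m < length (p i)" for i m
    proof -
      have "(\<Sum>v\<in>UNIV. K $ (p i ! m) $ v * x v) = (\<Sum>v\<in>UNIV. if v = p i ! Suc m then x v else 0)"
      proof (rule sum.cong)
        fix v
        have "(\<exists>j\<in>R. \<exists>l. Suc l < length (p j) \<and> p i ! m = p j ! l \<and> v = p j ! Suc l) \<longleftrightarrow> v = p i ! Suc m"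
          using that uniq[OF that(1)] by (metis Suc_lessD)
        then show "K $ (p i ! m) $ v * x v = (if v = p i ! Suc m then x v else 0)" by (simp add: K_def)
      qed simp
      moreover have "(\<Sum>j\<in>UNIV. if p i ! m = last (p j) \<and> j \<in> R then y j else 0) = 0"
      proof (rule sum.neutral, safe)
        fix j
        have False if "p i ! m = last (p j)" "j \<in> R"
          using that uniq[of i j m "length (p j) - 1"] \<open>i \<in> R\<close> \<open>Suc m < length (p i)\<close> P(1)[of j]
          by (auto simp: last_conv_nth)
        then show "(if p i ! m = last (p j) \<and> j \<in> R then y j else 0) = 0" by auto
      qed
      ultimately show ?thesis using rowl[of "p i ! m"] by simp
    qed
    have on: "x (p i ! m) = 0" if "i \<in> R" "m < length (p i)" for i m
      using that(2)
    proof (induction m)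
      case 0
      then show ?case using hd0[OF that(1)] P(1)[OF that(1)] by (simp add: hd_conv_nth)
    next
      case (Suc m)
      then show ?case using step[OF that(1)] by simp
    qed
    \<comment> \<open>At the last vertex the row of \<open>K\<close> is zero and only column
      \<open>i\<close> of \<open>C\<close> is active, so the equation reads
      \<open>x ?u = - y i\<close>.\<close>
    have y0: "y i = 0" if "i \<in> R" for i
    proof -
      let ?u = "last (p i)"
      have u: "?u = p i ! (length (p i) - 1)" "length (p i) - 1 < length (p i)"
        using P(1)[OF that] by (auto simp: last_conv_nth)
      have "K $ ?u $ v = 0" for v
      proof -
        have "\<not> (Suc l < length (p j) \<and> ?u = p j ! l)" if "j \<in> R" for j l
          using uniq[OF \<open>i \<in> R\<close> that, of "length (p i) - 1" l] u by auto
        then show ?thesis by (auto simp: K_def)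
      qed
      moreover have "(\<Sum>j\<in>UNIV. if ?u = last (p j) \<and> j \<in> R then y j else 0) = (\<Sum>j\<in>UNIV. if j = i then y j else 0)"
      proof (rule sum.cong)
        fix j
        have "j = i" if j: "?u = last (p j)" "j \<in> R"
        proof (rule ccontr)
          assume "j \<noteq> i"
          then have "set (p i) \<inter> set (p j) = {}" using disj \<open>i \<in> R\<close> j(2) by blast
          moreover have "?u \<in> set (p i)" using P(1)[OF \<open>i \<in> R\<close>] by simp
          moreover have "?u \<in> set (p j)" using P(1)[OF j(2)] unfolding j(1) by simp
          ultimately show False by blast
        qed
        then show "(if ?u = last (p j) \<and> j \<in> R then y j else 0) = (if j = i then y j else 0)"
          using that by auto
      qed simp
      moreover have "x ?u = 0" using on[OF that u(2)] u(1) by simp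
      ultimately show ?thesis using rowl[of ?u] by simp
    qed
    have "x u = 0" for u
    proof (cases "\<exists>i\<in>R. \<exists>m<length (p i). u = p i ! m")
      case False
      have "K $ u $ v = 0" for v
        \<comment> \<open>Off the paths the row of \<open>K\<close> is zero and all
          \<open>y j\<close> with \<open>j \<in> R\<close> are known to vanish, which leaves
          \<open>x u = 0\<close>.\<close>
        using False by (auto simp: K_def dest: Suc_lessD)
      moreover have "(\<Sum>j\<in>UNIV. if u = last (p j) \<and> j \<in> R then y j else 0) = 0"
        using y0 by (intro sum.neutral) auto
      ultimately show ?thesis using rowl[of u] by simp
    qed (use on in auto)
    moreover have "y j = 0" for j using y0 yout by blast
    ultimately have "z $ a = 0" for a by (cases a) (auto simp: x_def y_def)
    then show "z = 0" by (simp add: vec_eq_iff)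
  qed
  then have "det ?M \<noteq> 0"
    by (metis invertible_det_nz invertible_left_inverse matrix_left_invertible_ker)
  ultimately show ?thesis using that by blast
qed

section \<open>The matrix \<open>F\<close> as a compression of the inverse\<close>

lemma mult_diag_matrix: "(A ** diag_matrix d) $ a $ b = (A $ a $ b * d b :: 'a::semiring_1)"
  by (simp add: matrix_matrix_mult_def diag_matrix_def if_distrib[of "\<lambda>x. _ * x"] cong: if_cong)

text \<open>The outer factors \<open>loop_adjacency G\<close> restrict the double sum to the closed
  out-neighbourhood of \<open>s\<close> and the closed in-neighbourhood of \<open>t\<close>; the
  diagonal matrices supply row \<open>i\<close> of \<open>B\<close> and column \<open>j\<close> of
  \<open>C\<close>.\<close>

lemma F_matrix_eq:
  fixes G :: "('v::finite, 'e) pre_digraph"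
  shows "F_matrix G K B C s t =
    restrict_cols {u. u = s \<or> (s, u) \<in> arcs_ends G} B ** matrix_inv (mat 1 - K) **
    restrict_rows {v. v = t \<or> (v, t) \<in> arcs_ends G} C"
proof -
  let ?N = "matrix_inv (mat 1 - K)"
  have "F_matrix G K B C s t $ i $ j =
    (\<Sum>v\<in>UNIV. (\<Sum>u\<in>UNIV. loop_adjacency G $ s $ u * B $ i $ u * ?N $ u $ v) * C $ v $ j * loop_adjacency G $ v $ t)" for i j
  proof -
    have "(loop_adjacency G ** P_matrix B i ** ?N) $ s $ v = (\<Sum>u\<in>UNIV. loop_adjacency G $ s $ u * B $ i $ u * ?N $ u $ v)" for v
      unfolding matrix_matrix_mult_def[of _ ?N] P_matrix_def by (simp add: mult_diag_matrix)
    then show ?thesis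
      unfolding F_matrix_def D_matrix_def matrix_matrix_mult_def[of _ "loop_adjacency G"] Q_matrix_def
      by (simp add: mult_diag_matrix)
  qed
  moreover have "(\<Sum>u\<in>UNIV. loop_adjacency G $ s $ u * B $ i $ u * ?N $ u $ v) * C $ v $ j * loop_adjacency G $ v $ t =
     (\<Sum>u\<in>UNIV. restrict_cols {u. u = s \<or> (s, u) \<in> arcs_ends G} B $ i $ u * ?N $ u $ v) *
      restrict_rows {v. v = t \<or> (v, t) \<in> arcs_ends G} C $ v $ j" for i j v
    by (auto simp: restrict_rows_def restrict_cols_def loop_adjacency_def intro!: arg_cong2[where f = "(*)"] sum.cong)
  ultimately show ?thesis
    by (simp add: vec_eq_iff matrix_matrix_mult_def)
qed

section \<open>Zeros of multi-affine functions of random matrices\<close>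

text \<open>Condition on the first component: the exceptional set \<open>A\<close> costs at most
  \<open>a\<close>, and every other value leaves a conditional probability of at most
  \<open>b\<close>.\<close>

lemma prob_pair_pmf_le:
  assumes "measure_pmf.prob p A \<le> a" and q: "\<And>x. x \<notin> A \<Longrightarrow> measure_pmf.prob q {y. Q x y} \<le> b" and "0 \<le> b"
  shows "measure_pmf.prob (pair_pmf p q) {(x, y). Q x y} \<le> a + b"
proof -
  have "emeasure (pair_pmf p q) {(x, y). Q x y} = (\<integral>\<^sup>+x. emeasure q {y. Q x y} \<partial>p)"
  proof -
    have "pair_pmf p q = bind_pmf p (\<lambda>x. map_pmf (Pair x) q)"
      by (simp add: pair_pmf_def map_pmf_def)
    then show ?thesis by (simp add: emeasure_bind_pmf vimage_def)
  qed
  also have "\<dots> \<le> (\<integral>\<^sup>+x. indicator A x + ennreal b \<partial>p)"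
  proof (rule nn_integral_mono)
    fix x
    show "emeasure q {y. Q x y} \<le> indicator A x + ennreal b"
    proof (cases "x \<in> A")
      case True
      then show ?thesis using measure_pmf.emeasure_le_1[of q] by (simp add: add_increasing2)
    next
      case False
      then show ?thesis using q by (simp add: measure_pmf.emeasure_eq_measure ennreal_leI)
    qed
  qed
  also have "\<dots> = emeasure p A + ennreal b"
    by (simp add: nn_integral_add)
  finally have "measure_pmf.prob (pair_pmf p q) {(x, y). Q x y} \<le> measure_pmf.prob p A + b"
    using \<open>0 \<le> b\<close> by (simp add: measure_pmf.emeasure_eq_measure flip: ennreal_plus)
  then show ?thesis using assms(1) by linarith
qed

text \<open>Being nonzero at \<open>c0\<close> excludes the zero polynomial, so there is at most one
  root.\<close>

lemma prob_affine_zero_le: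
  fixes a b :: "'a::{field,finite}"
  assumes "a + b * c0 \<noteq> 0"
  shows "measure_pmf.prob (pmf_of_set UNIV) {c. a + b * c = 0} \<le> 1 / CARD('a)"
proof -
  have "c = d" if "a + b * c = 0" "a + b * d = 0" for c d
  proof -
    have "b * c = b * d" using that by (metis add_left_imp_eq)
    moreover have "b \<noteq> 0" using that assms by auto
    ultimately show ?thesis by simp
  qed
  then have "card {c. a + b * c = 0} \<le> Suc 0"
    by (subst card_le_Suc0_iff_eq) auto
  then show ?thesis
    by (simp add: measure_pmf_of_set divide_right_mono)
qed

text \<open>The coefficients are chosen after \<open>g\<close> and may depend on all other
  coordinates.\<close>

definition affine_in :: "(('i \<Rightarrow> 'a::semiring_1) \<Rightarrow> 'a) \<Rightarrow> 'i \<Rightarrow> bool" where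
  "affine_in f x \<longleftrightarrow> (\<forall>g. \<exists>a b. \<forall>c. f (g(x := c)) = a + b * c)"

text \<open>
  \<open>D\<close> holds the coordinates on which \<open>f\<close> depends, so that rows of \<open>B\<close> and columns of \<open>C\<close> outside the
  chosen minor do not enter the bound.
\<close>
lemma prob_multiaffine_zero_le:
  fixes f :: "('i \<Rightarrow> 'a::{field,finite}) \<Rightarrow> 'a"
  assumes "finite S" "\<And>x. x \<in> S \<inter> D \<Longrightarrow> affine_in f x" "\<And>x g c. x \<in> S - D \<Longrightarrow> f (g(x := c)) = f g"
    "\<And>x. x \<notin> S \<Longrightarrow> g0 x = d" "f g0 \<noteq> 0"
  shows "measure_pmf.prob (Pi_pmf S d (\<lambda>_. pmf_of_set UNIV)) {g. f g = 0} \<le> card (S \<inter> D) / CARD('a)"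
  using assms
proof (induction S arbitrary: f g0 rule: finite_induct)
  case empty
  then have "g0 = (\<lambda>_. d)" by auto
  then show ?case using empty by (simp add: measure_return_pmf)
next
  case (insert x S)
  let ?U = "\<lambda>_. pmf_of_set (UNIV :: 'a set)"
  have prob_eq: "measure_pmf.prob (Pi_pmf (insert x S) d ?U) {g. f g = 0} =
      measure_pmf.prob (pair_pmf (Pi_pmf S d ?U) (pmf_of_set UNIV)) {(h, y). f (h(x := y)) = 0}"
    unfolding Pi_pmf_insert[OF insert.hyps] by (subst pair_commute_pmf) (simp add: vimage_def case_prod_beta)
  \<comment> \<open>Freezing coordinate \<open>x\<close> at its witness value leaves a function of
    the remaining coordinates that is still nonzero somewhere.\<close>
  define f' where "f' h = f (h(x := g0 x))" for h
  have IH: "measure_pmf.prob (Pi_pmf S d ?U) {h. f' h = 0} \<le> card (S \<inter> D) / CARD('a)"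
  \<comment> \<open>The witness is reset to the default at \<open>x\<close>, now outside the index
    set; \<open>f'\<close> overwrites that coordinate.\<close>
  proof (rule insert.IH[of f' "g0(x := d)"])
    fix y assume y: "y \<in> S \<inter> D"
    then have "x \<noteq> y" using insert.hyps(2) by auto
    then have "f' (h(y := c)) = f ((h(x := g0 x))(y := c))" for h c
      by (simp add: f'_def fun_upd_twist)
    then show "affine_in f' y" using insert.prems(1)[of y] y by (simp add: affine_in_def)
  next
    fix y h c assume y: "y \<in> S - D"
    then have "x \<noteq> y" using insert.hyps(2) by auto
    then have "f' (h(y := c)) = f ((h(x := g0 x))(y := c))"
      by (simp add: f'_def fun_upd_twist)
    also have "\<dots> = f' h" unfolding f'_def by (rule insert.prems(2)) (use y in simp)
    finally show "f' (h(y := c)) = f' h" .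
  next
    show "(g0(x := d)) y = d" if "y \<notin> S" for y using insert.prems(3)[of y] that by auto
    show "f' (g0(x := d)) \<noteq> 0" using insert.prems(4) by (simp add: f'_def)
  qed
  show ?case
  proof (cases "x \<in> D")
    case True
    \<comment> \<open>If \<open>f' h \<noteq> 0\<close>, the affine function of \<open>y\<close> is
      nonzero at \<open>g0 x\<close>.\<close>
    have "measure_pmf.prob (pmf_of_set UNIV) {y. f (h(x := y)) = 0} \<le> 1 / CARD('a)" if "h \<notin> {h. f' h = 0}" for h
    proof -
      obtain a b where ab: "\<And>c. f (h(x := c)) = a + b * c"
        using insert.prems(1)[of x] True unfolding affine_in_def by blast
      then show ?thesis using that prob_affine_zero_le[of a b "g0 x"] by (simp add: f'_def)
    qed
    then have "measure_pmf.prob (Pi_pmf (insert x S) d ?U) {g. f g = 0} \<le> card (S \<inter> D) / CARD('a) + 1 / CARD('a)"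
      unfolding prob_eq by (intro prob_pair_pmf_le[OF IH]) auto
    then show ?thesis using True insert.hyps by (simp add: Int_insert_left add_divide_distrib add.commute)
  next
    case False
    have "{y. f (h(x := y)) = 0} = {}" if "h \<notin> {h. f' h = 0}" for h
    proof -
      have "f (h(x := y)) = f h" for y by (rule insert.prems(2)) (use False in simp)
      then show ?thesis using that by (simp add: f'_def)
    qed
    then have "measure_pmf.prob (Pi_pmf (insert x S) d ?U) {g. f g = 0} \<le> card (S \<inter> D) / CARD('a) + 0"
      unfolding prob_eq by (intro prob_pair_pmf_le[OF IH]) auto
    then show ?thesis using False by simp
  qed
qed

lemma random_matrix_zero_le:
  fixes f :: "'a::{field,finite}^'n^'m \<Rightarrow> 'a"
  assumes "\<And>x. x \<in> S \<inter> D \<Longrightarrow> affine_in (\<lambda>g. f (\<chi> i j. g (i, j))) x"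
    and "\<And>x g c. x \<in> S - D \<Longrightarrow> f (\<chi> i j. (g(x := c)) (i, j)) = f (\<chi> i j. g (i, j))"
    and "\<And>i j. (i, j) \<notin> S \<Longrightarrow> M $ i $ j = 0" and "f M \<noteq> 0"
  shows "measure_pmf.prob (random_matrix S) {M. f M = 0} \<le> card (S \<inter> D) / CARD('a)"
proof -
  have "measure_pmf.prob (random_matrix S) {M. f M = 0} =
      measure_pmf.prob (Pi_pmf S 0 (\<lambda>_. pmf_of_set UNIV)) {g. f (\<chi> i j. g (i, j)) = 0}"
    unfolding random_matrix_def by (simp add: vimage_def)
  also have "\<dots> \<le> card (S \<inter> D) / CARD('a)"
    by (rule prob_multiaffine_zero_le[where ?g0.0 = "\<lambda>(i, j). M $ i $ j"]) (use assms in auto)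
  finally show ?thesis .
qed

text \<open>The zero matrix is a witness, as \<open>det (mat 1) = 1\<close>.\<close>

lemma prob_det_zero_le:
  "measure_pmf.prob (random_matrix E :: ('a::{field,finite}^'v^'v) pmf) {K. det (mat 1 - K) = 0} \<le> card E / CARD('a)"
proof -
  have "measure_pmf.prob (random_matrix E :: ('a^'v^'v) pmf) {K. det (mat 1 - K) = 0} \<le> card (E \<inter> UNIV) / CARD('a)"
  proof (rule random_matrix_zero_le[where M = 0])
    fix x :: "'v \<times> 'v"
    obtain u v where x: "x = (u, v)" by (cases x)
    show "affine_in (\<lambda>g. det (mat 1 - (\<chi> i j. g (i, j))) :: 'a) x"
      unfolding affine_in_def
      by (rule allI, rule det_affine_entry[where i = u and j = v and q = "-1"]) (auto simp: x)
  qed auto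
  then show ?thesis by simp
qed

text \<open>The witness is replaced in stages: first \<open>K\<close> is random with
  \<open>B0\<close> and \<open>C0\<close> kept, then \<open>B\<close> with \<open>C0\<close> kept,
  then \<open>C\<close>. Each stage adds the number of entries involved over
  \<open>CARD('a)\<close>.\<close>

lemma prob_bordered_zero_le:
  fixes K0 :: "'a::{field,finite}^'v^'v" and B0 :: "'a^'v^'k" and C0 :: "'a^'k^'v"
  assumes "\<And>u v. (u, v) \<notin> E \<Longrightarrow> K0 $ u $ v = 0" "det (bordered_matrix S T R K0 B0 C0) \<noteq> 0"
  shows "measure_pmf.prob
      (pair_pmf (random_matrix E) (pair_pmf (random_matrix UNIV) (random_matrix UNIV)))
      {(K :: 'a^'v^'v, B :: 'a^'v^'k, C :: 'a^'k^'v). det (bordered_matrix S T R K B C) = 0}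
    \<le> (card E + 2 * card R * CARD('v)) / CARD('a)"
proof -
  let ?d = "\<lambda>K B C. det (bordered_matrix S T R K B C :: 'a^('v + 'k)^('v + 'k))"
  let ?r = "card R * CARD('v) / CARD('a)"
  have cardB: "card (UNIV \<inter> R \<times> (UNIV :: 'v set)) = card R * CARD('v)"
    and cardC: "card (UNIV \<inter> (UNIV :: 'v set) \<times> R) = card R * CARD('v)"
    by (simp_all add: card_cartesian_product)
  have C: "measure_pmf.prob (random_matrix UNIV) {C. ?d K B C = 0} \<le> ?r" if "?d K B C0 \<noteq> 0" for K B
    unfolding cardC[symmetric]
  proof (rule random_matrix_zero_le[where M = C0])
    fix x :: "'v \<times> 'k"
    obtain u i where x: "x = (u, i)" by (cases x)
    show "affine_in (\<lambda>g. ?d K B (\<chi> i j. g (i, j))) x"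
      unfolding affine_in_def
      by (rule allI, rule det_affine_entry[where i = "Inl u" and j = "Inr i" and q = "if u \<in> T \<and> i \<in> R then 1 else 0"])
        (auto simp: x bordered_matrix_def split: sum.splits)
  next
    fix x :: "'v \<times> 'k" and g and c :: 'a assume x: "x \<in> UNIV - UNIV \<times> R"
    have "bordered_matrix S T R K B (\<chi> i j. (g(x := c)) (i, j)) = bordered_matrix S T R K B (\<chi> i j. g (i, j))"
      using x by (auto simp: bordered_matrix_def vec_eq_iff split: sum.splits)
    then show "?d K B (\<chi> i j. (g(x := c)) (i, j)) = ?d K B (\<chi> i j. g (i, j))" by simp
  qed (use that in auto)
  have B: "measure_pmf.prob (random_matrix UNIV) {B. ?d K B C0 = 0} \<le> ?r" if "?d K B0 C0 \<noteq> 0" for K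
    unfolding cardB[symmetric]
  proof (rule random_matrix_zero_le[where M = B0])
    fix x :: "'k \<times> 'v"
    obtain i u where x: "x = (i, u)" by (cases x)
    show "affine_in (\<lambda>g. ?d K (\<chi> i j. g (i, j)) C0) x"
      unfolding affine_in_def
      by (rule allI, rule det_affine_entry[where i = "Inr i" and j = "Inl u" and q = "if u \<in> S \<and> i \<in> R then 1 else 0"])
        (auto simp: x bordered_matrix_def split: sum.splits)
  next
    fix x :: "'k \<times> 'v" and g and c :: 'a assume x: "x \<in> UNIV - R \<times> UNIV"
    have "bordered_matrix S T R K (\<chi> i j. (g(x := c)) (i, j)) C0 = bordered_matrix S T R K (\<chi> i j. g (i, j)) C0"
      using x by (auto simp: bordered_matrix_def vec_eq_iff split: sum.splits)
    then show "?d K (\<chi> i j. (g(x := c)) (i, j)) C0 = ?d K (\<chi> i j. g (i, j)) C0" by simp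
  qed (use that in auto)
  have K: "measure_pmf.prob (random_matrix E) {K. ?d K B0 C0 = 0} \<le> card (E \<inter> UNIV) / CARD('a)"
  proof (rule random_matrix_zero_le[where M = K0])
    fix x :: "'v \<times> 'v"
    obtain u v where x: "x = (u, v)" by (cases x)
    show "affine_in (\<lambda>g. ?d (\<chi> i j. g (i, j)) B0 C0) x"
      unfolding affine_in_def
      by (rule allI, rule det_affine_entry[where i = "Inl u" and j = "Inl v" and q = "-1"])
        (auto simp: x bordered_matrix_def split: sum.splits)
  qed (use assms in auto)
  have BC: "measure_pmf.prob (pair_pmf (random_matrix UNIV) (random_matrix UNIV)) {(B, C). ?d K B C = 0} \<le> ?r + ?r"
    if "?d K B0 C0 \<noteq> 0" for K
    by (rule prob_pair_pmf_le[OF B[OF that]]) (use C in auto)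
  have "measure_pmf.prob (pair_pmf (random_matrix E) (pair_pmf (random_matrix UNIV) (random_matrix UNIV)))
      {(K, y). y \<in> {(B, C). ?d K B C = 0}} \<le> card (E \<inter> UNIV) / CARD('a) + (?r + ?r)"
    by (rule prob_pair_pmf_le[OF K]) (use BC in auto)
  also have "{(K, y). y \<in> {(B, C). ?d K B C = 0}} = {(K, B, C). ?d K B C = 0}" by auto
  finally show ?thesis by (simp add: add_divide_distrib)
qed

section \<open>Paths between two vertices\<close>

lemma invertible_matrix_inv:
  assumes "invertible (A :: 'a::semiring_1^'n^'m)"
  shows "A ** matrix_inv A = mat 1" "matrix_inv A ** A = mat 1"
  using someI_ex[OF assms[unfolded invertible_def]] by (simp_all add: matrix_inv_def)

lemma finite_linking_paths:
  fixes P :: "'v::finite list set"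
  assumes "\<forall>p\<in>P. linking_path E A B p"
  shows "finite P"
proof (rule finite_subset)
  show "P \<subseteq> {p. set p \<subseteq> UNIV \<and> distinct p}" using assms by (auto simp: linking_path_def)
qed (rule finite_subset_distinct, simp)

lemma vwalk_arcs_subset_iff: "set (vwalk_arcs p) \<subseteq> E \<longleftrightarrow> successively (\<lambda>u v. (u, v) \<in> E) p"
  by (induction p rule: vwalk_arcs.induct) auto

lemma st_paths_eq:
  assumes "verts G = UNIV"
  shows "st_paths G s t = {p. linking_path (arcs_ends G) {s} {t} p}"
  by (auto simp: st_paths_def vpath_def vwalk_def linking_path_def vwalk_arcs_subset_iff assms)

text \<open>Deleting \<open>s\<close> and \<open>t\<close> turns internally disjoint paths, other
  than the single arc, into fully disjoint paths from \<open>inner_sources\<close> to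
  \<open>inner_sinks\<close>.\<close>

definition inner_arcs :: "('v \<times> 'v) set \<Rightarrow> 'v \<Rightarrow> 'v \<Rightarrow> ('v \<times> 'v) set" where
  "inner_arcs E s t = {(u, v) \<in> E. u \<notin> {s, t} \<and> v \<notin> {s, t}}"

definition inner_sources :: "('v \<times> 'v) set \<Rightarrow> 'v \<Rightarrow> 'v \<Rightarrow> 'v set" where
  "inner_sources E s t = {v. (s, v) \<in> E} - {s, t}"

definition inner_sinks :: "('v \<times> 'v) set \<Rightarrow> 'v \<Rightarrow> 'v \<Rightarrow> 'v set" where
  "inner_sinks E s t = {v. (v, t) \<in> E} - {s, t}"

lemmas inner_defs = inner_arcs_def inner_sources_def inner_sinks_def

abbreviation inner_linking :: "('v \<times> 'v) set \<Rightarrow> 'v \<Rightarrow> 'v \<Rightarrow> 'v list \<Rightarrow> bool" where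
  "inner_linking E s t \<equiv> linking_path (inner_arcs E s t) (inner_sources E s t) (inner_sinks E s t)"

lemma inner_linking_avoids:
  assumes "inner_linking E s t m"
  shows "set m \<inter> {s, t} = {}"
proof -
  have "set m \<subseteq> - {s, t}"
    by (rule successively_closed[of "inner_arcs E s t" m "- {s, t}" "{}"])
      (use assms in \<open>auto simp: linking_path_def inner_defs\<close>)
  then show ?thesis by blast
qed

lemma extend_inner_linking:
  assumes "inner_linking E s t m" "s \<noteq> t"
  shows "linking_path E {s} {t} (s # m @ [t])"
proof -
  have m: "m \<noteq> []" "distinct m" "(s, hd m) \<in> E" "(last m, t) \<in> E"
      "successively (\<lambda>u v. (u, v) \<in> inner_arcs E s t) m"
    using assms(1) by (auto simp: linking_path_def inner_sources_def inner_sinks_def)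
  have "successively (\<lambda>u v. (u, v) \<in> E) m"
    by (rule successively_mono[OF m(5)]) (auto simp: inner_arcs_def)
  then show ?thesis using inner_linking_avoids[OF assms(1)] m assms(2)
    by (auto simp: linking_path_def successively_append_iff successively_Cons)
qed

text \<open>Excluding \<open>[s, t]\<close> makes the interior nonempty, and distinctness keeps it
  away from \<open>s\<close> and \<open>t\<close>.\<close>

lemma inner_linking_of_path:
  assumes p: "linking_path E {s} {t} p" and "s \<noteq> t" "p \<noteq> [s, t]"
  shows "inner_linking E s t (butlast (tl p))"
proof -
  define m where "m = butlast (tl p)"
  have "p = s # tl p" using p by (cases p) (auto simp: linking_path_def)
  moreover have "tl p \<noteq> []" using calculation p assms(2) by (metis last.simps linking_path_def singletonD)
  moreover have "last (tl p) = t" using p calculation by (metis last.simps linking_path_def singletonD)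
  ultimately have pm: "p = s # m @ [t]" unfolding m_def by (metis append_butlast_last_id)
  then have "m \<noteq> []" using assms(3) by auto
  have d: "distinct m" "s \<notin> set m" "t \<notin> set m" "(s, hd m) \<in> E" "(last m, t) \<in> E" "successively (\<lambda>u v. (u, v) \<in> E) m"
    using p \<open>m \<noteq> []\<close> unfolding pm by (auto simp: linking_path_def successively_append_iff successively_Cons)
  have "successively (\<lambda>u v. (u, v) \<in> inner_arcs E s t) m"
    by (rule successively_mono[OF d(6)]) (use d in \<open>auto simp: inner_arcs_def\<close>)
  moreover have "hd m \<in> set m" "last m \<in> set m" using \<open>m \<noteq> []\<close> by auto
  ultimately show ?thesis unfolding m_def[symmetric] using d \<open>m \<noteq> []\<close>
    by (auto simp: linking_path_def inner_sources_def inner_sinks_def)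
qed

text \<open>Every path except \<open>[s, t]\<close> has an internal vertex in \<open>X\<close>, and
  disjoint paths use different ones. Conversely, the paths in \<open>P\<close> extend to
  \<open>s\<close> and \<open>t\<close>, and an arc \<open>(s, t)\<close> contributes one
  more.\<close>

lemma vertex_connectivity_eq:
  fixes G :: "('v::finite, 'e) pre_digraph"
  defines "E \<equiv> arcs_ends G"
  assumes "verts G = UNIV" "s \<noteq> t"
    and X: "separator (inner_arcs E s t) (inner_sources E s t) (inner_sinks E s t) X"
    and P: "card P = card X" "disjoint_paths P" "\<forall>m\<in>P. inner_linking E s t m"
  shows "vertex_connectivity G s t = card X + (if (s, t) \<in> E then 1 else 0)"
  unfolding vertex_connectivity_def
proof (rule Max_eqI)
  have paths: "st_paths G s t = {p. linking_path E {s} {t} p}"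
    unfolding E_def using assms(2) by (rule st_paths_eq)
  have fin: "finite (st_paths G s t)"
    unfolding paths by (rule finite_linking_paths[of _ E "{s}" "{t}"]) simp
  have "{card S |S. S \<subseteq> st_paths G s t \<and> internally_disjoint S} \<subseteq> card ` Pow (st_paths G s t)"
    by auto
  then show "finite {card S |S. S \<subseteq> st_paths G s t \<and> internally_disjoint S}"
    by (rule finite_subset) (simp add: fin)
  show "c \<le> card X + (if (s, t) \<in> E then 1 else 0)"
    if c: "c \<in> {card S |S. S \<subseteq> st_paths G s t \<and> internally_disjoint S}" for c
  proof -
    obtain S where S: "c = card S" "S \<subseteq> st_paths G s t" "internally_disjoint S" using c by blast
    have finS: "finite S" using S(2) fin by (rule finite_subset)
    define f where "f p = (SOME x. x \<in> internal_vertices p \<inter> X)" for p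
    have f: "f p \<in> internal_vertices p \<inter> X" if "p \<in> S - {[s, t]}" for p
    proof -
      have "linking_path E {s} {t} p" "p \<noteq> [s, t]" using that S(2) unfolding paths by auto
      then have "inner_linking E s t (butlast (tl p))"
        using inner_linking_of_path[OF _ assms(3)] by blast
      then have "internal_vertices p \<inter> X \<noteq> {}"
        unfolding internal_vertices_def by (rule linking_path_meets_separator[OF X])
      then show ?thesis unfolding f_def by (meson ex_in_conv someI_ex)
    qed
    have "inj_on f (S - {[s, t]})"
    proof (rule inj_onI, rule ccontr)
      fix p q assume pq: "p \<in> S - {[s, t]}" "q \<in> S - {[s, t]}" "f p = f q" "p \<noteq> q"
      then have "internal_vertices p \<inter> internal_vertices q = {}"
        using S(3) unfolding internally_disjoint_def by blast
      then show False using f[OF pq(1)] f[OF pq(2)] pq(3) by auto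
    qed
    then have le: "card (S - {[s, t]}) \<le> card X"
      by (rule card_inj_on_le) (use f in auto)
    show ?thesis
    proof (cases "[s, t] \<in> S")
      case True
      then have "(s, t) \<in> E" using S(2) unfolding paths by (auto simp: linking_path_def)
      moreover have "card S = Suc (card (S - {[s, t]}))" using True finS by (metis card_Suc_Diff1)
      ultimately show ?thesis using le S(1) by simp
    qed (use le S(1) in simp)
  qed
  let ?g = "\<lambda>m. s # m @ [t]"
  define D where "D = (if (s, t) \<in> E then {[s, t]} else {})"
  define S where "S = ?g ` P \<union> D"
  have "S \<subseteq> st_paths G s t"
  proof -
    have "?g m \<in> st_paths G s t" if "m \<in> P" for m
      unfolding paths using extend_inner_linking[OF P(3)[rule_format, OF that] assms(3)] by simp
    moreover have "D \<subseteq> st_paths G s t"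
      using assms(3) by (auto simp: D_def paths linking_path_def)
    ultimately show ?thesis unfolding S_def by blast
  qed
  moreover have "internally_disjoint S"
  proof -
    have "internal_vertices (?g m) = set m" for m by (simp add: internal_vertices_def butlast_append)
    moreover have "internal_vertices [s, t] = {}" by (simp add: internal_vertices_def)
    moreover have "set m \<inter> set m' = {}" if "m \<in> P" "m' \<in> P" "m \<noteq> m'" for m m'
      using P(2) that by (auto simp: disjoint_paths_def)
    ultimately show ?thesis by (auto simp: internally_disjoint_def S_def D_def split: if_splits)
  qed
  moreover have "card S = card X + (if (s, t) \<in> E then 1 else 0)"
  proof -
    have "finite P"
      using P(3) by (rule finite_linking_paths)
    moreover have "?g ` P \<inter> D = {}" using P(3) by (auto simp: D_def linking_path_def)
    moreover have "card (?g ` P) = card P" by (rule card_image) (auto simp: inj_on_def)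
    ultimately show ?thesis unfolding S_def using P(1) by (subst card_Un_disjoint) (auto simp: D_def)
  qed
  ultimately show "card X + (if (s, t) \<in> E then 1 else 0) \<in> {card S |S. S \<subseteq> st_paths G s t \<and> internally_disjoint S}"
    by (intro CollectI exI[of _ S]) simp
qed

section \<open>Separators and linkings of closed neighbourhoods\<close>

abbreviation closed_out :: "('v \<times> 'v) set \<Rightarrow> 'v \<Rightarrow> 'v set" where
  "closed_out E s \<equiv> {u. u = s \<or> (s, u) \<in> E}"

abbreviation closed_in :: "('v \<times> 'v) set \<Rightarrow> 'v \<Rightarrow> 'v set" where
  "closed_in E t \<equiv> {v. v = t \<or> (v, t) \<in> E}"

text \<open>If \<open>(s, t)\<close> is an arc, both closed neighbourhoods contain \<open>s\<close>
  and \<open>t\<close>, so the separator must too. Otherwise neither is added, and any occurrence in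
  \<open>X\<close> is removed.\<close>

lemma closed_separator:
  assumes "separator (inner_arcs E s t) (inner_sources E s t) (inner_sinks E s t) X" "s \<noteq> t"
  shows "separator E (closed_out E s) (closed_in E t) (if (s, t) \<in> E then X \<union> {s, t} else X - {s, t})"
proof -
  obtain U where U: "U \<inter> X = {}" "inner_sources E s t \<subseteq> U \<union> X" "inner_sinks E s t \<inter> U = {}"
      "inner_arcs E s t `` U \<subseteq> U \<union> X"
    using assms(1) by (auto simp: separator_def)
  have src: "v \<in> U \<union> X" if "(s, v) \<in> E" "v \<noteq> s" "v \<noteq> t" for v
    using U(2) that by (auto simp: inner_sources_def)
  have snk: "v \<notin> U" if "(v, t) \<in> E" "v \<noteq> s" "v \<noteq> t" for v
    using U(3) that by (auto simp: inner_sinks_def)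
  have arc: "v \<in> U \<union> X" if "u \<in> U" "(u, v) \<in> E" "u \<noteq> s" "u \<noteq> t" "v \<noteq> s" "v \<noteq> t" for u v
    using U(4) that by (auto simp: inner_arcs_def)
  show ?thesis
  proof (cases "(s, t) \<in> E")
    case True
    have "separator E (closed_out E s) (closed_in E t) (X \<union> {s, t})"
    proof (rule separatorI[where U = "U - {s, t}"])
      fix u v assume "u \<in> U - {s, t}" "(u, v) \<in> E"
      then show "v \<in> U - {s, t} \<union> (X \<union> {s, t})" using arc[of u v] by auto
    next
      show "closed_out E s \<subseteq> U - {s, t} \<union> (X \<union> {s, t})" using src by auto
      show "closed_in E t \<inter> (U - {s, t}) = {}" using snk by auto
    qed (use U(1) in auto)
    then show ?thesis using True by simp
  next
    case False
    \<comment> \<open>Here \<open>s\<close> joins the source side and \<open>t\<close> stays off it: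
      no vertex of that side has an arc to \<open>t\<close>.\<close>
    have "separator E (closed_out E s) (closed_in E t) (X - {s, t})"
    proof (rule separatorI[where U = "insert s (U - {t})"])
      fix u v assume u: "u \<in> insert s (U - {t})" "(u, v) \<in> E"
      show "v \<in> insert s (U - {t}) \<union> (X - {s, t})"
      proof (cases "u = s")
        case True
        then show ?thesis using u(2) False src[of v] by auto
      next
        case False
        then have "v \<noteq> t" using snk[of u] u by auto
        then show ?thesis using arc[of u v] False u by auto
      qed
    next
      show "closed_out E s \<subseteq> insert s (U - {t}) \<union> (X - {s, t})"
        using src False by auto
      show "closed_in E t \<inter> insert s (U - {t}) = {}"
        using snk False assms(2) by auto
    qed (use U(1) in auto)
    then show ?thesis using False by simp
  qed
qed

text \<open>For an arc \<open>(s, t)\<close>, the one-vertex paths \<open>[s]\<close> and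
  \<open>[t]\<close> are two further linking paths, disjoint from the inner ones.\<close>

lemma closed_linking_family:
  assumes P: "finite P" "disjoint_paths P" "\<forall>m\<in>P. inner_linking E s t m" and "s \<noteq> t"
  obtains Q where "finite Q" "disjoint_paths Q" "\<forall>q\<in>Q. linking_path E (closed_out E s) (closed_in E t) q"
    "card Q = card P + (if (s, t) \<in> E then 2 else 0)"
proof -
  define D where "D = (if (s, t) \<in> E then {[s], [t]} else {})"
  have avoid: "set m \<inter> {s, t} = {}" if "m \<in> P" for m
    by (rule inner_linking_avoids[OF P(3)[rule_format, OF that]])
  have "linking_path E (closed_out E s) (closed_in E t) m" if "m \<in> P" for m
    by (rule linking_path_mono[of "inner_arcs E s t" "inner_sources E s t" "inner_sinks E s t"])
      (use P(3) that in \<open>auto simp: inner_defs\<close>)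
  moreover have "linking_path E (closed_out E s) (closed_in E t) m" if "m \<in> D" for m
    using that by (auto simp: D_def linking_path_def split: if_splits)
  moreover have "disjoint_paths (P \<union> D)"
    using P(2) avoid assms(4) by (auto simp: disjoint_paths_def D_def split: if_splits)
  moreover have "P \<inter> D = {}" using avoid[of "[s]"] avoid[of "[t]"] by (auto simp: D_def split: if_splits)
  then have "card (P \<union> D) = card P + (if (s, t) \<in> E then 2 else 0)"
    using P(1) assms(4) by (subst card_Un_disjoint) (auto simp: D_def)
  moreover have "finite (P \<union> D)" using P(1) by (simp add: D_def)
  ultimately show ?thesis using that[of "P \<union> D"] by blast
qed

section \<open>Rank of \<open>F\<close> against vertex connectivity\<close>

text \<open>A nonzero entry of \<open>I - K\<close> is diagonal or sits on an arc, so the witness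
  \<open>U\<close> of the graph separator has the vanishing block needed by
  \<open>rank_separated_le\<close>.\<close>

lemma rank_F_matrix_le:
  fixes G :: "('v::finite, 'e) pre_digraph" and K :: "'a::field^'v^'v"
    and B :: "'a^'v^'k::finite" and C :: "'a^'k^'v"
  assumes "invertible (mat 1 - K)" "\<And>u v. (u, v) \<notin> arcs_ends G \<Longrightarrow> K $ u $ v = 0"
    and "separator (arcs_ends G) (closed_out (arcs_ends G) s) (closed_in (arcs_ends G) t) X"
  shows "rank (F_matrix G K B C s t) \<le> card X"
proof -
  obtain U where U: "U \<inter> X = {}" "closed_out (arcs_ends G) s \<subseteq> U \<union> X"
      "closed_in (arcs_ends G) t \<inter> U = {}" "arcs_ends G `` U \<subseteq> U \<union> X"
    using assms(3) by (auto simp: separator_def)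
  show ?thesis
    unfolding F_matrix_eq
  proof (rule rank_separated_le[OF invertible_matrix_inv(1)[OF assms(1)] _ _ _ U(1)])
    fix u v assume uv: "u \<in> U" "(mat 1 - K) $ u $ v \<noteq> 0"
    then have "u = v \<or> (u, v) \<in> arcs_ends G" using assms(2)[of u v] by (auto simp: mat_def split: if_splits)
    then show "v \<in> U \<union> X" using uv(1) U(4) by auto
  next
    fix i u assume "restrict_cols (closed_out (arcs_ends G) s) B $ i $ u \<noteq> 0"
    then show "u \<in> U \<union> X" using U(2) by (auto simp: restrict_cols_def split: if_splits)
  next
    fix v j assume "restrict_rows (closed_in (arcs_ends G) t) C $ v $ j \<noteq> 0"
    then show "v \<notin> U" using U(3) by (auto simp: restrict_rows_def split: if_splits)
  qed
qed

lemma rank_le_rows: "rank (A :: 'a::field^'n^'m) \<le> CARD('m)"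
proof -
  have "rank A \<le> card (range (\<lambda>i. A $ i))"
    unfolding rank_eq_dim_nth by (rule vec.dim_le_card) (auto intro: vec.span_base)
  also have "\<dots> \<le> CARD('m)" by (rule card_image_le) simp
  finally show ?thesis .
qed

text \<open>Integer subtraction keeps rank \<open>0\<close> distinct from rank
  \<open>1\<close>.\<close>

definition rank_correct :: "('v::finite, 'e) pre_digraph \<Rightarrow> nat \<Rightarrow> 'a::field^'v^'v \<Rightarrow>
    'a^'v^'k \<Rightarrow> 'a^'k::finite^'v \<Rightarrow> 'v \<Rightarrow> 'v \<Rightarrow> bool" where
  "rank_correct G k K B C s t \<longleftrightarrow>
    (if (s, t) \<in> arcs_ends G
     then int (rank (F_matrix G K B C s t)) - 1 = int (min k (vertex_connectivity G s t))
     else min k (rank (F_matrix G K B C s t)) = min k (vertex_connectivity G s t))"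

text \<open>
  The set \<open>R\<close> indexes a minor of \<open>F\<close> of order \<open>min (k + 1) q\<close>, where \<open>q\<close> is the number of disjoint
  paths from the closed out-neighbourhood of \<open>s\<close> to the closed in-neighbourhood of \<open>t\<close>; the witness
  \<open>(K0, B0, C0)\<close> shows that its determinant polynomial is not identically zero.
\<close>
lemma rank_correct_certificate:
  fixes G :: "('v::finite, 'e) pre_digraph"
  assumes "verts G = UNIV" "s \<noteq> t" "CARD('k) = k + 1"
  obtains S T and R :: "'k::finite set" and K0 :: "'a::field^'v^'v" and B0 :: "'a^'v^'k::finite" and C0 :: "'a^'k::finite^'v" where
    "card R \<le> CARD('v)"
    "\<And>u v. (u, v) \<notin> arcs_ends G \<Longrightarrow> K0 $ u $ v = 0" "det (bordered_matrix S T R K0 B0 C0) \<noteq> 0"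
    "\<And>(K :: 'a^'v^'v) (B :: 'a^'v^'k) (C :: 'a^'k::finite^'v). invertible (mat 1 - K) \<Longrightarrow>
       (\<And>u v. (u, v) \<notin> arcs_ends G \<Longrightarrow> K $ u $ v = 0) \<Longrightarrow>
       det (bordered_matrix S T R K B C) \<noteq> 0 \<Longrightarrow> rank_correct G k K B C s t"
proof -
  let ?E = "arcs_ends G"
  let ?S = "closed_out ?E s" and ?T = "closed_in ?E t"
  obtain X P where XP: "separator (inner_arcs ?E s t) (inner_sources ?E s t) (inner_sinks ?E s t) X"
      "card P = card X" "disjoint_paths P" "\<forall>m\<in>P. inner_linking ?E s t m"
    using menger_sets[of "inner_arcs ?E s t" "inner_sources ?E s t" "inner_sinks ?E s t"] by auto
  have "finite P"
    using XP(4) by (rule finite_linking_paths)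
  then obtain Q where Q: "finite Q" "disjoint_paths Q" "\<forall>q\<in>Q. linking_path ?E ?S ?T q"
      "card Q = card X + (if (s, t) \<in> ?E then 2 else 0)"
    by (rule closed_linking_family[OF _ XP(3,4) assms(2)]) (auto simp: XP(2))
  have nu: "vertex_connectivity G s t = card X + (if (s, t) \<in> ?E then 1 else 0)"
    using vertex_connectivity_eq[OF assms(1,2) XP] .
  \<comment> \<open>Distinct first vertices bound the order of the minor by the number of vertices,
    so the error bound does not grow with \<open>k\<close>.\<close>
  have "inj_on hd Q"
  proof (rule inj_onI)
    fix p q assume pq: "p \<in> Q" "q \<in> Q" "hd p = hd q"
    then have "p \<noteq> []" "q \<noteq> []" using Q(3) by (auto simp: linking_path_def)
    then show "p = q"
      using disjoint_pathsD[OF Q(2) pq(1,2), of "hd p"] pq(3) hd_in_set[of p] hd_in_set[of q] by simp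
  qed
  then have cardQ: "card Q \<le> CARD('v)" by (metis card_image card_mono finite subset_UNIV)
  obtain R :: "'k set" where R: "card R = min (k + 1) (card Q)"
    using obtain_subset_with_card_n[of "min (k + 1) (card Q)" "UNIV :: 'k set"] assms(3) by (metis min.cobounded1)
  obtain p where p: "p ` R \<subseteq> Q" "inj_on p R"
    using card_le_inj[of R Q] R Q(1) by auto
  obtain K0 :: "'a^'v^'v" and B0 :: "'a^'v^'k" and C0 where
    0: "\<And>u v. (u, v) \<notin> ?E \<Longrightarrow> K0 $ u $ v = 0" "det (bordered_matrix ?S ?T R K0 B0 C0) \<noteq> 0"
  proof (rule bordered_det_nonzero[of R ?E ?S ?T p])
    show "linking_path ?E ?S ?T (p i)" if "i \<in> R" for i using that p(1) Q(3) by blast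
    show "set (p i) \<inter> set (p j) = {}" if "i \<in> R" "j \<in> R" "i \<noteq> j" for i j
      using that p Q(2) unfolding disjoint_paths_def inj_on_def by blast
  qed blast
  have correct: "rank_correct G k K B C s t"
    if K: "invertible (mat 1 - K)" "\<And>u v. (u, v) \<notin> ?E \<Longrightarrow> K $ u $ v = 0"
      and det: "det (bordered_matrix ?S ?T R K B C) \<noteq> 0"
    for K :: "'a^'v^'v" and B :: "'a^'v^'k" and C :: "'a^'k^'v"
  proof -
    let ?F = "F_matrix G K B C s t"
    have "card R \<le> rank ?F"
      unfolding F_matrix_eq by (rule card_le_rank_bordered[OF invertible_matrix_inv(2)[OF K(1)] det])
    moreover have "rank ?F \<le> k + 1" using rank_le_rows[of ?F] assms(3) by simp
    moreover have "rank ?F \<le> card X + (if (s, t) \<in> ?E then 2 else 0)"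
    proof -
      have "rank ?F \<le> card (if (s, t) \<in> ?E then X \<union> {s, t} else X - {s, t})"
        by (rule rank_F_matrix_le[OF K closed_separator[OF XP(1) assms(2)]])
      also have "\<dots> \<le> card X + (if (s, t) \<in> ?E then 2 else 0)"
      proof (cases "(s, t) \<in> ?E")
        case True
        have "card (X \<union> {s, t}) \<le> card X + card {s, t}" by (rule card_Un_le)
        then show ?thesis using True assms(2) by simp
      next
        case False
        then show ?thesis by (simp add: card_mono)
      qed
      finally show ?thesis .
    qed
    \<comment> \<open>The rank is exactly \<open>min (k + 1) (card Q)\<close>. For an arc
      \<open>card Q\<close> is the connectivity plus one, hence the subtraction of \<open>1\<close>;
      otherwise it is the connectivity.\<close>
    ultimately show ?thesis unfolding rank_correct_def nu using R Q(4) by (auto split: if_splits)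
  qed
  have "card R \<le> CARD('v)" using R cardQ by simp
  then show ?thesis by (rule that) (fact 0 correct)+
qed

text \<open>The upper bound on the rank is deterministic but needs \<open>K\<close> to vanish off
  the arcs, which holds on the support.\<close>

lemma random_matrix_support:
  assumes "K \<in> set_pmf (random_matrix E :: ('a::{finite,zero}^'n^'m) pmf)" "(u, v) \<notin> E"
  shows "K $ u $ v = 0"
proof -
  obtain g where "g \<in> set_pmf (Pi_pmf E 0 (\<lambda>_. pmf_of_set (UNIV :: 'a set)))" "K = (\<chi> i j. g (i, j))"
    using assms(1) by (auto simp: random_matrix_def)
  then show ?thesis using set_Pi_pmf_subset[of E 0] assms(2) by (auto simp: subset_iff)
qed

section \<open>Union bound over all pairs of vertices\<close>

theorem theorem15:
  fixes G :: "('v::finite, 'e) pre_digraph"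
    and n k p :: nat
  assumes "digraph G"
    and "verts G = UNIV"
    and "CARD('v) = n"
    and "k > 0"
    and "CARD('k::finite) = k + 1"
    and "CARD('p::prime_card) = p"
    and "p \<ge> 2 * n ^ 5"
  shows "measure_pmf.prob
      (pair_pmf (random_matrix (arcs_ends G) :: ('p mod_ring^'v^'v) pmf)
        (pair_pmf (random_matrix UNIV :: ('p mod_ring^'v^'k) pmf)
                  (random_matrix UNIV :: ('p mod_ring^'k^'v) pmf)))
      {(K, B, C).
         invertible (mat 1 - K) \<and>
         (\<forall>s t. s \<noteq> t \<longrightarrow>
            (if (s, t) \<in> arcs_ends G
             then int (rank (F_matrix G K B C s t)) - 1 = int (min k (vertex_connectivity G s t))
             else min k (rank (F_matrix G K B C s t)) = min k (vertex_connectivity G s t)))}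
    \<ge> 1 - 5 / real n"
proof -
  let ?E = "arcs_ends G"
  let ?W = "pair_pmf (random_matrix ?E :: ('p mod_ring^'v^'v) pmf)
        (pair_pmf (random_matrix UNIV :: ('p mod_ring^'v^'k) pmf)
                  (random_matrix UNIV :: ('p mod_ring^'k^'v) pmf))"
  let ?good = "{(K :: 'p mod_ring^'v^'v, B :: 'p mod_ring^'v^'k, C :: 'p mod_ring^'k^'v).
      invertible (mat 1 - K) \<and> (\<forall>s t. s \<noteq> t \<longrightarrow> rank_correct G k K B C s t)}"
  have n: "n \<ge> 1" using assms(3) by (metis One_nat_def Suc_leI zero_less_card_finite)
  have cardE: "card ?E \<le> n\<^sup>2"
  proof -
    have "card ?E \<le> card (UNIV :: ('v \<times> 'v) set)" by (rule card_mono) auto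
    then show ?thesis using assms(3) by (simp add: power2_eq_square)
  qed
  define bad0 :: "(('p mod_ring^'v^'v) \<times> ('p mod_ring^'v^'k) \<times> ('p mod_ring^'k^'v)) set" where
    "bad0 = {(K, y). det (mat 1 - K) = 0}"
  have "measure_pmf.prob ?W bad0 \<le> card ?E / CARD('p mod_ring) + 0"
    unfolding bad0_def by (rule prob_pair_pmf_le[OF prob_det_zero_le]) auto
  then have bad0: "measure_pmf.prob ?W bad0 \<le> n\<^sup>2 / p"
    using cardE assms(6) by (simp add: divide_right_mono order_trans)
  have "\<exists>Bad. measure_pmf.prob ?W Bad \<le> 3 * n\<^sup>2 / p \<and>
      (\<forall>K B C. (\<forall>u v. (u, v) \<notin> ?E \<longrightarrow> K $ u $ v = 0) \<longrightarrow> invertible (mat 1 - K) \<longrightarrow>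
        (K, B, C) \<notin> Bad \<longrightarrow> rank_correct G k K B C s t)"
    if st: "s \<noteq> t" for s t
  proof -
    obtain S T R and K0 :: "'p mod_ring^'v^'v" and B0 :: "'p mod_ring^'v^'k" and C0 where
      R: "card R \<le> CARD('v)"
      and 0: "\<And>u v. (u, v) \<notin> ?E \<Longrightarrow> K0 $ u $ v = 0" "det (bordered_matrix S T R K0 B0 C0) \<noteq> 0"
      and correct: "\<And>(K :: 'p mod_ring^'v^'v) (B :: 'p mod_ring^'v^'k) (C :: 'p mod_ring^'k^'v).
        invertible (mat 1 - K) \<Longrightarrow> (\<And>u v. (u, v) \<notin> ?E \<Longrightarrow> K $ u $ v = 0) \<Longrightarrow>
        det (bordered_matrix S T R K B C) \<noteq> 0 \<Longrightarrow> rank_correct G k K B C s t"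
      by (rule rank_correct_certificate[OF assms(2) st assms(5)]) blast
    let ?Bad = "{(K, B, C). det (bordered_matrix S T R K B C :: 'p mod_ring^('v + 'k)^('v + 'k)) = 0}"
    \<comment> \<open>At most \<open>n\<^sup>2\<close> entries each of \<open>K\<close>,
      \<open>B\<close> and \<open>C\<close> enter, hence the constant \<open>3\<close>.\<close>
    have "measure_pmf.prob ?W ?Bad \<le> real (card ?E + 2 * card R * CARD('v)) / real p"
      using prob_bordered_zero_le[OF 0] assms(6) by simp
    also have "\<dots> \<le> real (3 * n\<^sup>2) / real p"
    proof -
      have "2 * card R * CARD('v) \<le> 2 * n * n" using R assms(3) by (simp add: mult_le_mono)
      then have "card ?E + 2 * card R * CARD('v) \<le> 3 * n\<^sup>2"
        using cardE by (simp add: power2_eq_square)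
      then show ?thesis by (intro divide_right_mono) (simp_all only: of_nat_le_iff of_nat_0_le_iff)
    qed
    finally show ?thesis using correct by (intro exI[of _ ?Bad]) auto
  qed
  then obtain Bad where Bad: "\<And>s t. s \<noteq> t \<Longrightarrow> measure_pmf.prob ?W (Bad s t) \<le> 3 * n\<^sup>2 / p"
      "\<And>s t K B C. s \<noteq> t \<Longrightarrow> (\<forall>u v. (u, v) \<notin> ?E \<longrightarrow> K $ u $ v = 0) \<Longrightarrow> invertible (mat 1 - K) \<Longrightarrow>
        (K, B, C) \<notin> Bad s t \<Longrightarrow> rank_correct G k K B C s t"
    by metis
  define I where "I = {(s, t). s \<noteq> (t :: 'v)}"
  let ?bad = "bad0 \<union> (\<Union>(s, t)\<in>I. Bad s t)"
  have cardI: "card I \<le> n\<^sup>2"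
  proof -
    have "card I \<le> card (UNIV :: ('v \<times> 'v) set)" by (rule card_mono) auto
    then show ?thesis using assms(3) by (simp add: power2_eq_square)
  qed
  have "measure_pmf.prob ?W ?bad \<le> measure_pmf.prob ?W bad0 + measure_pmf.prob ?W (\<Union>(s, t)\<in>I. Bad s t)"
    by (rule measure_Un_le) auto
  also have "measure_pmf.prob ?W (\<Union>(s, t)\<in>I. Bad s t) \<le> (\<Sum>(s, t)\<in>I. measure_pmf.prob ?W (Bad s t))"
    using measure_UNION_le[of I "\<lambda>(s, t). Bad s t" ?W] by (simp add: case_prod_beta)
  also have "\<dots> \<le> (\<Sum>(s, t)\<in>I. 3 * n\<^sup>2 / p)"
    by (rule sum_mono) (use Bad(1) in \<open>auto simp: I_def\<close>)
  also have "\<dots> = card I * (3 * n\<^sup>2 / p)" by (simp add: case_prod_beta)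
  also have "\<dots> \<le> real (n\<^sup>2) * (3 * n\<^sup>2 / p)"
    using cardI by (intro mult_right_mono) (simp_all only: of_nat_le_iff divide_nonneg_nonneg of_nat_0_le_iff)
  finally have "measure_pmf.prob ?W ?bad \<le> n\<^sup>2 / p + real (n\<^sup>2) * (3 * n\<^sup>2 / p)"
    using bad0 by simp
  also have "\<dots> \<le> 5 / n"
  proof -
    \<comment> \<open>Estimating \<open>n\<^sup>2\<close> by \<open>n ^ 4\<close> gives
      \<open>4 * n ^ 4 / p\<close>, which is at most \<open>2 / n\<close> and so within
      \<open>5 / n\<close>.\<close>
    have "real (n\<^sup>2) \<le> real n ^ 4" using n by (simp add: power_increasing)
    then have "n\<^sup>2 / p + real (n\<^sup>2) * (3 * n\<^sup>2 / p) \<le> 4 * real n ^ 4 / p"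
      by (simp add: add_divide_distrib[symmetric] divide_right_mono power2_eq_square power4_eq_xxxx)
    also have "\<dots> \<le> 4 * real n ^ 4 / (2 * real n ^ 5)"
    proof (rule divide_left_mono)
      have "0 < 2 * real n ^ 5" using n by simp
      show "2 * real n ^ 5 \<le> real p" using assms(7) by (metis of_nat_le_iff of_nat_mult of_nat_numeral of_nat_power)
      then show "0 < real p * (2 * real n ^ 5)" using \<open>0 < 2 * real n ^ 5\<close> by (meson less_le_trans mult_pos_pos)
    qed simp
    also have "\<dots> = 2 / n" using n by (simp add: field_simps power_numeral_reduce)
    also have "\<dots> \<le> 5 / n" by (simp add: divide_right_mono)
    finally show ?thesis .
  qed
  finally have "1 - 5 / n \<le> 1 - measure_pmf.prob ?W ?bad" by simp
  also have "\<dots> = measure_pmf.prob ?W (- ?bad)"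
    using measure_pmf.prob_compl[of ?bad ?W] by (simp add: Compl_eq_Diff_UNIV)
  also have "\<dots> \<le> measure_pmf.prob ?W ?good"
  \<comment> \<open>The inclusion is only almost sure, since \<open>K\<close> is supported on the
    arcs only within \<open>set_pmf\<close>.\<close>
  proof (rule measure_pmf.finite_measure_mono_AE)
    show "AE x in ?W. x \<in> - ?bad \<longrightarrow> x \<in> ?good"
    proof (rule AE_pmfI, rule impI)
      fix x assume x: "x \<in> set_pmf ?W" "x \<in> - ?bad"
      obtain K B C where KBC: "x = (K, B, C)" by (cases x)
      have "\<forall>u v. (u, v) \<notin> ?E \<longrightarrow> K $ u $ v = 0"
        using x(1) random_matrix_support unfolding KBC by auto
      moreover have "invertible (mat 1 - K)"
        using x(2) by (auto simp: KBC bad0_def invertible_det_nz)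
      moreover have "(K, B, C) \<notin> Bad s t" if "s \<noteq> t" for s t
        using x(2) that by (auto simp: KBC I_def)
      ultimately show "x \<in> ?good" using Bad(2) by (simp add: KBC)
    qed
  qed auto
  finally show ?thesis by (simp only: rank_correct_def)
qed

end
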